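(* Let $f\in\mathcal{B}$ and suppose that $A\subset\mathbb{C}$ is closed and connected such that $f(A)\subset A$ and such that $f\colon A\to\overline{f(A)}$ is a homeomorphism. Then for every $R>0$ there exists $R'>0$ such that \[\{z\in A\colon |z|\geq R'\}\subset\{z\in\mathbb{C}\colon |f^n(z)|\geq R\text{ for all } n\geq 0\text{ and }|f^n(z)|\to\infty\text{ as }n\to\infty\}.\]
   Context: All closures are taken in $\mathbb{C}$. For an entire function $f$, $\operatorname{sing}(f^{-1})$ consists of all finite critical values and finite asymptotic values of $f$, and $S(f):=\overline{\operatorname{sing}(f^{-1})}$. The Eremenko-Lyubich class $\mathcal{B}$ is the set of all transcendental entire functions $f\colon\mathbb{C}\to\mathbb{C}$ for which $S(f)$ is bounded. $f^n$ denotes the $n$-th iterate of $f$. *)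

theory Defs
  imports "HOL-Complex_Analysis.Complex_Analysis" "HOL-Computational_Algebra.Polynomial"
begin

definition transcendental_entire :: "(complex \<Rightarrow> complex) \<Rightarrow> bool" where
  "transcendental_entire f \<longleftrightarrow> f holomorphic_on UNIV \<and> \<not> (\<exists>p. \<forall>z. f z = poly p z)"

definition critical_values :: "(complex \<Rightarrow> complex) \<Rightarrow> complex set" where
  "critical_values f = {f c | c. deriv f c = 0}"

(* Finiteness of the asymptotic values is implicit in their type. *)
definition asymptotic_values :: "(complex \<Rightarrow> complex) \<Rightarrow> complex set" where
  "asymptotic_values f =
     {a. \<exists>\<gamma> :: real \<Rightarrow> complex. continuous_on {0..} \<gamma> \<and>
           filterlim \<gamma> at_infinity at_top \<and> ((\<lambda>t. f (\<gamma> t)) \<longlongrightarrow> a) at_top}"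

definition sing_inv :: "(complex \<Rightarrow> complex) \<Rightarrow> complex set" where
  "sing_inv f = critical_values f \<union> asymptotic_values f"

definition singular_set :: "(complex \<Rightarrow> complex) \<Rightarrow> complex set" where
  "singular_set f = closure (sing_inv f)"

definition eremenko_lyubich :: "(complex \<Rightarrow> complex) set" where
  "eremenko_lyubich = {f. transcendental_entire f \<and> bounded (singular_set f)}"

end

theory Submission
  imports Defs "HOL-Real_Asymp.Real_Asymp"
begin

text \<open>The proof works in logarithmic coordinates. Let \<open>R\<close> bound the singular values and \<open>\<bar>f 0\<bar>\<close>, and let
  \<open>H = {\<zeta>. ln R < Re \<zeta>}\<close>. Since nothing in \<open>{w. R < \<bar>w\<bar>}\<close> is a critical or asymptotic value, \<open>exp\<close>
  lifts through \<open>f\<close> to maps \<open>g\<close> on \<open>H\<close>; these are injective because \<open>f\<close> is not a polynomial. Their inverses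
  give a continuous branch \<open>\<phi>\<close> of \<open>ln \<circ> f\<close> on \<open>{z. R < \<bar>f z\<bar>}\<close>, and \<open>\<phi> \<circ> exp\<close> has local
  sections \<open>G\<close> defined on all of \<open>H\<close>, with small derivative far to the right.

  As a homeomorphism onto a closed set, \<open>f\<close> is proper on \<open>A\<close>. For
  \<open>z \<in> A\<close> with \<open>\<bar>f z\<bar>\<close> large, connectedness of \<open>A\<close> yields \<open>x \<in> A\<close> in the compact set \<open>\<bar>f x\<bar> = \<rho>\<close>
  with \<open>\<phi> z\<close>, \<open>\<phi> x\<close> in the image of a single \<open>G\<close>; contraction of \<open>G\<close> gives
  \<open>\<bar>\<phi> (f z)\<bar> \<ge> 4 * \<bar>\<phi> z\<bar> - const\<close>. So \<open>\<bar>\<phi>\<bar>\<close> grows along the orbit; and as \<open>\<phi>\<close> is bounded on bounded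
  parts of \<open>A\<close>, the orbit tends to infinity.\<close>

section \<open>Uniqueness of lifts, local inverses and gluing\<close>

text \<open>The set of agreement is closed by continuity. It is open because \<open>f\<close> is
  injective near \<open>g y\<close> wherever \<open>deriv f (g y)\<close> is nonzero: close to a
  point \<open>y\<close> of agreement, both maps take values in such a disc and have equal images
  under \<open>f\<close>.\<close>

lemma lift_unique:
  fixes f :: "complex \<Rightarrow> complex" and g h :: "'a::topological_space \<Rightarrow> complex"
  assumes holf: "f holomorphic_on UNIV" and S: "connected S"
    and g: "continuous_on S g" and h: "continuous_on S h"
    and eq: "\<And>x. x \<in> S \<Longrightarrow> f (g x) = f (h x)"
    and nz: "\<And>x. x \<in> S \<Longrightarrow> deriv f (g x) \<noteq> 0"
    and a: "a \<in> S" "g a = h a" and x: "x \<in> S"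
  shows "g x = h x"
proof -
  define T where "T = {x \<in> S. g x = h x}"
  have "closedin (top_of_set S) {x \<in> S. g x - h x = 0}"
    by (intro continuous_closedin_preimage_constant continuous_intros g h)
  then have cl: "closedin (top_of_set S) T"
    by (simp add: T_def)
  have op: "openin (top_of_set S) T"
  proof (subst openin_subopen, intro ballI)
    fix y assume y: "y \<in> T"
    obtain r where r: "r > 0" "inj_on f (ball (g y) r)"
      using has_complex_derivative_locally_injective[OF holf, of "g y"] nz y unfolding T_def
      by (metis (mono_tags, lifting) UNIV_I mem_Collect_eq open_UNIV)
    define N where "N = (S \<inter> g -` ball (g y) r) \<inter> (S \<inter> h -` ball (g y) r)"
    have "openin (top_of_set S) N"
      unfolding N_def by (intro openin_Int continuous_openin_preimage_gen g h open_ball)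
    moreover have "y \<in> N" using y r by (auto simp: N_def T_def)
    moreover have "N \<subseteq> T"
      using r(2) eq by (auto simp: N_def T_def inj_on_def)
    ultimately show "\<exists>N. openin (top_of_set S) N \<and> y \<in> N \<and> N \<subseteq> T" by blast
  qed
  have "T = {} \<or> T = S" using S cl op by (auto simp: connected_clopen)
  then show ?thesis using a x by (auto simp: T_def)
qed

text \<open>Both inverse laws serve the extension of lifts of a map \<open>p\<close>: the first
  makes \<open>k \<circ> p\<close> a lift, the second identifies it with a given lift whose values
  are close to \<open>x\<close>.\<close>

lemma holomorphic_local_inverse:
  fixes f :: "complex \<Rightarrow> complex"
  assumes holf: "f holomorphic_on UNIV" and nz: "deriv f x \<noteq> 0"
  obtains N k r where "open N" "f x \<in> N" "k holomorphic_on N" "\<And>y. y \<in> N \<Longrightarrow> f (k y) = y"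
    "0 < r" "\<And>z. z \<in> ball x r \<Longrightarrow> f z \<in> N \<and> k (f z) = z"
proof -
  obtain r where r: "r > 0" "inj_on f (ball x r)"
    using has_complex_derivative_locally_injective[OF holf _ open_UNIV nz] by blast
  have holr: "f holomorphic_on ball x r" using holf holomorphic_on_subset by blast
  obtain k where k: "k holomorphic_on (f ` ball x r)" "\<And>z. z \<in> ball x r \<Longrightarrow> k (f z) = z"
    by (rule holomorphic_has_inverse[OF holr open_ball r(2)]) (rule that)
  show thesis
  proof (rule that)
    show "open (f ` ball x r)" by (rule open_mapping_thm3[OF holr open_ball r(2)])
    show "f (k y) = y" if "y \<in> f ` ball x r" for y using that k(2) by fastforce
    show "f z \<in> f ` ball x r \<and> k (f z) = z" if "z \<in> ball x r" for z using that k(2) by blast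
  qed (use r k(1) in auto)
qed

lemma holomorphic_glue:
  fixes h :: "'i \<Rightarrow> complex \<Rightarrow> complex"
  assumes op: "\<And>i. i \<in> I \<Longrightarrow> open (U i)" and hol: "\<And>i. i \<in> I \<Longrightarrow> h i holomorphic_on U i"
    and agree: "\<And>i j x. i \<in> I \<Longrightarrow> j \<in> I \<Longrightarrow> x \<in> U i \<Longrightarrow> x \<in> U j \<Longrightarrow> h i x = h j x"
  obtains g where "g holomorphic_on (\<Union>i\<in>I. U i)" "\<And>i x. i \<in> I \<Longrightarrow> x \<in> U i \<Longrightarrow> g x = h i x"
proof -
  define g where "g x = h (SOME i. i \<in> I \<and> x \<in> U i) x" for x
  have g: "g x = h i x" if "i \<in> I" "x \<in> U i" for i x
  proof -
    have "(SOME i. i \<in> I \<and> x \<in> U i) \<in> I \<and> x \<in> U (SOME i. i \<in> I \<and> x \<in> U i)"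
      by (rule someI[of _ i]) (use that in auto)
    then show ?thesis unfolding g_def using agree that by blast
  qed
  have "g holomorphic_on U i" if "i \<in> I" for i
    using holomorphic_transform[OF hol[OF that]] g that by metis
  then have "g holomorphic_on (\<Union>i\<in>I. U i)"
    using op by (simp add: holomorphic_on_UN_open)
  with g show thesis using that by blast
qed

subsection \<open>Lifting through a function without large singular values\<close>

text \<open>The bound on \<open>f 0\<close> keeps 0 out of \<open>{z. R < norm (f z)}\<close>, so
  that lifts of \<open>exp\<close> omit 0 and have holomorphic logarithms.\<close>

locale class_B_covering =
  fixes f :: "complex \<Rightarrow> complex" and R :: real
  assumes holo: "f holomorphic_on UNIV"
    and not_poly: "\<not> (\<exists>p. \<forall>z. f z = poly p z)"
    and R_pos: "0 < R"
    and norm_f_0: "norm (f 0) \<le> R"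
    and deriv_nz: "\<And>z. R < norm (f z) \<Longrightarrow> deriv f z \<noteq> 0"
    and asymp: "\<And>a. R < norm a \<Longrightarrow> a \<notin> asymptotic_values f"
begin

lemma cont: "continuous_on S f"
  using holo holomorphic_on_imp_continuous_on continuous_on_subset by blast

text \<open>A path tending to infinity would make \<open>a\<close> an asymptotic value. So the path
  returns to some disc at times tending to 1 and accumulates at a point \<open>x\<close> with
  \<open>f x = a\<close>. On a small circle around \<open>x\<close>, \<open>f\<close> stays away
  from \<open>a\<close>, so the end of the path cannot cross that circle and remains inside
  it.\<close>

lemma path_lift_limit:
  assumes \<gamma>: "continuous_on {0..<1} \<gamma>"
    and lim: "((\<lambda>t. f (\<gamma> t)) \<longlongrightarrow> a) (at_left (1::real))" and a: "R < norm a"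
  obtains x where "f x = a" "(\<gamma> \<longlongrightarrow> x) (at_left 1)"
proof -
  have "\<not> filterlim \<gamma> at_infinity (at_left 1)"
  proof
    assume inf: "filterlim \<gamma> at_infinity (at_left 1)"
    \<comment> \<open>This reparametrises \<open>{0..<1}\<close> by \<open>{0..}\<close>, the domain
      of the paths that define asymptotic values.\<close>
    have re: "filterlim (\<lambda>t::real. 1 - 1 / (t + 1)) (at_left 1) at_top"
      by real_asymp
    have "continuous_on {0..} (\<lambda>t. \<gamma> (1 - 1 / (t + 1)))"
      by (rule continuous_on_compose2[OF \<gamma>]) (auto intro!: continuous_intros)
    moreover have "filterlim (\<lambda>t. \<gamma> (1 - 1 / (t + 1))) at_infinity at_top"
      by (rule filterlim_compose[OF inf re])
    moreover have "((\<lambda>t. f (\<gamma> (1 - 1 / (t + 1)))) \<longlongrightarrow> a) at_top"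
      by (rule filterlim_compose[OF lim re])
    ultimately have "a \<in> asymptotic_values f"
      unfolding asymptotic_values_def by blast
    with asymp a show False by blast
  qed
  then obtain B where B: "\<not> eventually (\<lambda>t. B \<le> norm (\<gamma> t)) (at_left 1)"
    by (auto simp: filterlim_at_infinity[OF order_refl])
  have "\<exists>t. 1 - 1 / (real n + 2) < t \<and> t < 1 \<and> norm (\<gamma> t) \<le> B" for n
  proof (rule ccontr)
    assume "\<not> ?thesis"
    then have "eventually (\<lambda>t. B \<le> norm (\<gamma> t)) (at_left 1)"
      unfolding eventually_at_left_field
      by (intro exI[of _ "1 - 1 / (real n + 2)"]) (auto simp: not_le intro: less_imp_le)
    with B show False by blast
  qed
  then obtain t where t: "\<And>n. 1 - 1 / (real n + 2) < t n" "\<And>n. t n < 1" "\<And>n. norm (\<gamma> (t n)) \<le> B"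
    by metis
  have t1: "t \<longlonglongrightarrow> 1"
  proof (rule tendsto_sandwich[OF _ _ _ tendsto_const])
    show "(\<lambda>n. 1 - 1 / (real n + 2)) \<longlonglongrightarrow> 1" by real_asymp
  qed (use t in \<open>auto intro!: always_eventually less_imp_le\<close>)
  obtain x \<sigma> where \<sigma>: "strict_mono \<sigma>" "((\<gamma> \<circ> t) \<circ> \<sigma>) \<longlonglongrightarrow> x"
    using compact_cball[of 0 B] t(3) unfolding compact_def by (metis comp_apply mem_cball_0)
  have t2: "(t \<circ> \<sigma>) \<longlonglongrightarrow> 1" using LIMSEQ_subseq_LIMSEQ[OF t1 \<sigma>(1)] .
  then have t3: "filterlim (t \<circ> \<sigma>) (at_left 1) sequentially"
    by (auto simp: filterlim_at less_imp_neq[OF t(2)] t(2))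
  have "(\<lambda>n. f (\<gamma> (t (\<sigma> n)))) \<longlonglongrightarrow> a"
    using filterlim_compose[OF lim t3] by simp
  moreover have "(\<lambda>n. f (\<gamma> (t (\<sigma> n)))) \<longlonglongrightarrow> f x"
    using \<sigma>(2) by (intro isCont_tendsto_compose[of _ f])
      (use cont[of UNIV] in \<open>auto simp: continuous_on_eq_continuous_at o_def\<close>)
  ultimately have fx: "f x = a" using LIMSEQ_unique by blast
  obtain r where r: "r > 0" "inj_on f (ball x r)"
    using has_complex_derivative_locally_injective[OF holo, of x] deriv_nz fx a by auto
  have "(\<gamma> \<longlongrightarrow> x) (at_left 1)"
  proof (rule tendstoI)
    fix e :: real assume e: "0 < e"
    define d where "d = min e r / 2"
    have d: "0 < d" "d < e" "d < r" using e r by (auto simp: d_def)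
    have ne: "sphere x d \<noteq> {}" using d by simp
    obtain y where y: "y \<in> sphere x d" "\<And>z. z \<in> sphere x d \<Longrightarrow> dist (f y) a \<le> dist (f z) a"
      using continuous_attains_inf[OF compact_sphere ne, of "\<lambda>z. dist (f z) a"]
        continuous_on_dist[OF cont continuous_on_const] by blast
    have "f y \<noteq> f x"
    proof
      assume "f y = f x"
      moreover have "y \<in> ball x r" "x \<in> ball x r" using y d r by auto
      ultimately have "y = x" using r(2) by (auto dest: inj_onD)
      then show False using y d by simp
    qed
    then have "dist (f y) a > 0" using fx by simp
    with lim have "eventually (\<lambda>t. dist (f (\<gamma> t)) a < dist (f y) a) (at_left 1)"
      by (rule tendstoD)
    then obtain b where b: "b < 1" "\<And>t. b < t \<Longrightarrow> t < 1 \<Longrightarrow> dist (f (\<gamma> t)) a < dist (f y) a"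
      unfolding eventually_at_left_field by blast
    define b' where "b' = max b 0"
    have "eventually (\<lambda>n. dist (\<gamma> (t (\<sigma> n))) x < d) sequentially"
      using tendstoD[OF \<sigma>(2) d(1)] by simp
    moreover have "eventually (\<lambda>n. b' < t (\<sigma> n)) sequentially"
      using order_tendstoD(1)[OF t2, of b'] b by (simp add: b'_def)
    ultimately have "eventually (\<lambda>n. dist (\<gamma> (t (\<sigma> n))) x < d \<and> b' < t (\<sigma> n)) sequentially"
      by (rule eventually_conj)
    then obtain n where n: "dist (\<gamma> (t (\<sigma> n))) x < d" "b' < t (\<sigma> n)"
      using eventually_sequentially by auto
    let ?S = "\<gamma> ` {b'<..<1}"
    have con: "connected ?S"
      by (intro connected_continuous_image continuous_on_subset[OF \<gamma>]) (auto simp: b'_def)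
    have "?S \<subseteq> ball x d"
    proof (rule ccontr)
      assume "\<not> ?thesis"
      then have "?S - ball x d \<noteq> {}" by blast
      moreover have "?S \<inter> ball x d \<noteq> {}" using n t(2) by (force simp: dist_commute)
      ultimately have "?S \<inter> frontier (ball x d) \<noteq> {}" using connected_Int_frontier[OF con] by blast
      then obtain t' where "t' \<in> {b'<..<1}" "\<gamma> t' \<in> sphere x d"
        unfolding frontier_ball[OF d(1)] by blast
      then show False using b y by (force simp: b'_def)
    qed
    then have "\<And>t. b' < t \<Longrightarrow> t < 1 \<Longrightarrow> dist (\<gamma> t) x < e"
      using d by (force simp: dist_commute)
    moreover have "b' < 1" using b by (simp add: b'_def)
    ultimately show "eventually (\<lambda>t. dist (\<gamma> t) x < e) (at_left 1)"
      unfolding eventually_at_left_field by blast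
  qed
  with fx show thesis using that by blast
qed

text \<open>The lift \<open>g\<close> is followed along the radius towards \<open>\<eta>\<close>.
  Its values have a finite limit \<open>x\<close> by \<open>path_lift_limit\<close>, and a local
  inverse of \<open>f\<close> at \<open>x\<close> continues the lift across
  \<open>\<eta>\<close>.\<close>

lemma lift_local_extension:
  assumes holp: "p holomorphic_on ball 0 1"
    and pR: "\<And>u. u \<in> ball 0 1 \<Longrightarrow> R < norm (p u)"
    and s: "0 < s" "s < 1"
    and g: "g holomorphic_on ball 0 s" "\<And>u. u \<in> ball 0 s \<Longrightarrow> f (g u) = p u"
    and \<eta>: "\<eta> \<in> cball (0::complex) s"
  obtains \<epsilon> h where "0 < \<epsilon>" "ball \<eta> \<epsilon> \<subseteq> ball 0 1" "h holomorphic_on ball \<eta> \<epsilon>"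
    "\<And>u. u \<in> ball \<eta> \<epsilon> \<Longrightarrow> f (h u) = p u" "\<And>u. u \<in> ball \<eta> \<epsilon> \<Longrightarrow> u \<in> ball 0 s \<Longrightarrow> h u = g u"
proof -
  have p: "continuous_on (ball 0 1) p" "p holomorphic_on ball 0 1"
    using holp holomorphic_on_imp_continuous_on by blast+
  have \<eta>1: "\<eta> \<in> ball 0 1" using \<eta> s by simp
  have inb: "of_real t * \<eta> \<in> ball 0 s" if "t \<in> {0..<1}" for t
  proof -
    have "norm (of_real t * \<eta>) \<le> t * s" using that \<eta> by (auto simp: norm_mult intro: mult_left_mono)
    also have "\<dots> < s" using that s by simp
    finally show ?thesis by simp
  qed
  have rad: "((\<lambda>t. of_real t * \<eta>) \<longlongrightarrow> \<eta>) (at_left (1::real))"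
    by (rule tendsto_eq_intros | simp)+
  have left: "eventually (\<lambda>t. t \<in> {0..<1}) (at_left (1::real))"
    unfolding eventually_at_left_field by (intro exI[of _ 0]) auto
  define \<gamma> where "\<gamma> t = g (of_real t * \<eta>)" for t
  have c\<gamma>: "continuous_on {0..<1} \<gamma>"
    unfolding \<gamma>_def
    by (rule continuous_on_compose2[OF holomorphic_on_imp_continuous_on[OF g(1)]])
      (use inb in \<open>auto intro!: continuous_intros\<close>)
  have "((\<lambda>t. p (of_real t * \<eta>)) \<longlongrightarrow> p \<eta>) (at_left (1::real))"
    using p(1) \<eta>1 by (intro isCont_tendsto_compose[OF _ rad]) (auto simp: continuous_on_eq_continuous_at)
  then have "((\<lambda>t. f (\<gamma> t)) \<longlongrightarrow> p \<eta>) (at_left 1)"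
    by (rule Lim_transform_eventually)
      (use left g(2) inb in \<open>auto simp: \<gamma>_def elim!: eventually_mono\<close>)
  then obtain x where x: "f x = p \<eta>" "(\<gamma> \<longlongrightarrow> x) (at_left 1)"
    using path_lift_limit[OF c\<gamma>] pR \<eta>1 by blast
  have "deriv f x \<noteq> 0" using deriv_nz pR x \<eta>1 by simp
  then obtain N k r where N: "open N" "f x \<in> N" "k holomorphic_on N" "\<And>y. y \<in> N \<Longrightarrow> f (k y) = y"
    "0 < r" "\<And>z. z \<in> ball x r \<Longrightarrow> f z \<in> N \<and> k (f z) = z"
    using holomorphic_local_inverse[OF holo] by blast
  have "open (ball 0 1 \<inter> p -` N)"
    using continuous_open_preimage[OF p(1) open_ball N(1)] .
  then obtain \<epsilon> where \<epsilon>: "0 < \<epsilon>" "ball \<eta> \<epsilon> \<subseteq> ball 0 1 \<inter> p -` N"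
    using \<eta>1 N(2) x(1) open_contains_ball[of "ball 0 1 \<inter> p -` N"]
    by (metis IntI vimageI)
  define h where "h = k \<circ> p"
  have h: "h holomorphic_on ball \<eta> \<epsilon>" unfolding h_def
    by (rule holomorphic_on_compose_gen[OF _ N(3)]) (use \<epsilon> p(2) holomorphic_on_subset in auto)
  have fh: "f (h u) = p u" if "u \<in> ball \<eta> \<epsilon>" for u
    using that \<epsilon> N(4) by (auto simp: h_def)
  have "eventually (\<lambda>t. dist (\<gamma> t) x < r) (at_left 1)" using tendstoD[OF x(2) N(5)] .
  moreover have "eventually (\<lambda>t. dist (of_real t * \<eta>) \<eta> < \<epsilon>) (at_left (1::real))"
    using tendstoD[OF rad \<epsilon>(1)] .
  \<comment> \<open>One such \<open>t\<close> is enough: there the new lift equals \<open>g\<close>,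
    and \<open>lift_unique\<close> spreads the agreement over the convex set
    \<open>?S\<close>.\<close>
  ultimately have "eventually (\<lambda>t. dist (\<gamma> t) x < r \<and> dist (of_real t * \<eta>) \<eta> < \<epsilon> \<and> t \<in> {0..<1}) (at_left 1)"
    using left by eventually_elim simp
  then obtain t where t: "dist (\<gamma> t) x < r" "dist (of_real t * \<eta>) \<eta> < \<epsilon>" "t \<in> {0..<1}"
    using eventually_happens trivial_limit_at_left_real by blast
  let ?S = "ball \<eta> \<epsilon> \<inter> ball 0 s"
  have "h u = g u" if u: "u \<in> ball \<eta> \<epsilon>" "u \<in> ball 0 s" for u
  proof (rule lift_unique[OF holo, of ?S h g "of_real t * \<eta>"])
    show "connected ?S" by (intro convex_connected convex_Int convex_ball)
    show "continuous_on ?S h" using h holomorphic_on_imp_continuous_on continuous_on_subset by blast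
    show "continuous_on ?S g" using g(1) holomorphic_on_imp_continuous_on continuous_on_subset by blast
    show "of_real t * \<eta> \<in> ?S" using t inb by (auto simp: dist_commute)
    have "k (f (\<gamma> t)) = \<gamma> t" using N(6)[of "\<gamma> t"] t by (auto simp: dist_commute)
    then show "h (of_real t * \<eta>) = g (of_real t * \<eta>)"
      using g(2)[OF inb[OF t(3)]] by (simp add: h_def \<gamma>_def)
    show "f (h v) = f (g v)" if "v \<in> ?S" for v using that fh g by auto
    show "deriv f (h v) \<noteq> 0" if "v \<in> ?S" for v
      using that fh \<epsilon> pR by (intro deriv_nz) (auto simp: subset_iff)
  qed (use u in auto)
  note hg = this
  have "ball \<eta> \<epsilon> \<subseteq> ball 0 1" using \<epsilon>(2) by simp
  then show thesis by (rule that[OF \<epsilon>(1) _ h fh hg])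
qed

text \<open>The local extensions at all points of the closed disc agree on overlaps, so they glue to
  a lift on an open set containing the disc. By compactness that set contains a larger concentric
  disc, up to radius 1.\<close>

lemma lift_extend:
  assumes holp: "p holomorphic_on ball 0 1"
    and pR: "\<And>u. u \<in> ball 0 1 \<Longrightarrow> R < norm (p u)"
    and s: "0 < s" "s < 1"
    and g: "g holomorphic_on ball (0::complex) s" "\<And>u. u \<in> ball 0 s \<Longrightarrow> f (g u) = p u"
  obtains s' g' where "s < s'" "s' \<le> 1" "g' holomorphic_on ball 0 s'"
    "\<And>u. u \<in> ball 0 s' \<Longrightarrow> f (g' u) = p u" "g' 0 = g 0"
proof -
  let ?C = "cball (0::complex) s"
  define P where "P \<eta> \<epsilon> h \<longleftrightarrow> 0 < \<epsilon> \<and> ball \<eta> \<epsilon> \<subseteq> ball 0 1 \<and> h holomorphic_on ball \<eta> \<epsilon> \<and>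
    (\<forall>u\<in>ball \<eta> \<epsilon>. f (h u) = p u) \<and> (\<forall>u\<in>ball \<eta> \<epsilon> \<inter> ball 0 s. h u = g u)" for \<eta> \<epsilon> h
  have "\<exists>\<epsilon> h. P \<eta> \<epsilon> h" if \<eta>: "\<eta> \<in> ?C" for \<eta>
  proof (rule lift_local_extension[OF holp pR s g \<eta>])
    fix \<epsilon> h assume "0 < \<epsilon>" "ball \<eta> \<epsilon> \<subseteq> ball 0 1" "h holomorphic_on ball \<eta> \<epsilon>"
      "\<And>u. u \<in> ball \<eta> \<epsilon> \<Longrightarrow> f (h u) = p u" "\<And>u. u \<in> ball \<eta> \<epsilon> \<Longrightarrow> u \<in> ball 0 s \<Longrightarrow> h u = g u"
    then have "P \<eta> \<epsilon> h" unfolding P_def by simp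
    then show ?thesis by blast
  qed
  then obtain \<epsilon> h where P: "\<And>\<eta>. \<eta> \<in> ?C \<Longrightarrow> P \<eta> (\<epsilon> \<eta>) (h \<eta>)"
    by metis
  have \<epsilon>: "\<And>\<eta>. \<eta> \<in> ?C \<Longrightarrow> 0 < \<epsilon> \<eta>" "\<And>\<eta>. \<eta> \<in> ?C \<Longrightarrow> ball \<eta> (\<epsilon> \<eta>) \<subseteq> ball 0 1"
    and h: "\<And>\<eta>. \<eta> \<in> ?C \<Longrightarrow> h \<eta> holomorphic_on ball \<eta> (\<epsilon> \<eta>)"
      "\<And>\<eta> u. \<eta> \<in> ?C \<Longrightarrow> u \<in> ball \<eta> (\<epsilon> \<eta>) \<Longrightarrow> f (h \<eta> u) = p u"
      "\<And>\<eta> u. \<eta> \<in> ?C \<Longrightarrow> u \<in> ball \<eta> (\<epsilon> \<eta>) \<Longrightarrow> u \<in> ball 0 s \<Longrightarrow> h \<eta> u = g u"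
    using P unfolding P_def by blast+
  have agree: "h \<eta> u = h \<eta>' u"
    if \<eta>: "\<eta> \<in> ?C" "\<eta>' \<in> ?C" and u: "u \<in> ball \<eta> (\<epsilon> \<eta>)" "u \<in> ball \<eta>' (\<epsilon> \<eta>')" for \<eta> \<eta>' u
  proof -
    let ?O = "ball \<eta> (\<epsilon> \<eta>) \<inter> ball \<eta>' (\<epsilon> \<eta>')"
    \<comment> \<open>Projecting to the closed disc does not increase distances to its points, so \<open>?O\<close> meets
      the closed disc and hence the open one.\<close>
    define v where "v = closest_point ?C u"
    have C: "convex ?C" "closed ?C" "?C \<noteq> {}" using s by auto
    have "dist v \<eta>'' \<le> dist u \<eta>''" if "\<eta>'' \<in> ?C" for \<eta>''
      using closest_point_lipschitz[OF C, of u \<eta>''] closest_point_self[OF that] by (simp add: v_def)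
    then have "v \<in> ?O" using \<eta> u by (metis IntI dist_commute mem_ball order_le_less_trans)
    moreover have "v \<in> closure (ball 0 s)"
      using closest_point_in_set[OF C(2,3)] s by (simp add: v_def)
    ultimately have "?O \<inter> ball 0 s \<noteq> {}"
      by (metis IntI disjoint_iff open_Int open_Int_closure_eq_empty open_ball)
    then obtain w where w: "w \<in> ?O" "w \<in> ball 0 s" by blast
    show ?thesis
    proof (rule lift_unique[OF holo, of ?O "h \<eta>" "h \<eta>'" w])
      show "connected ?O" by (intro convex_connected convex_Int convex_ball)
      show "continuous_on ?O (h \<eta>)" "continuous_on ?O (h \<eta>')"
        using h(1) \<eta> holomorphic_on_imp_continuous_on continuous_on_subset by (metis inf_le1 inf_le2)+
      show "h \<eta> w = h \<eta>' w" using h(3) \<eta> w by auto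
      show "f (h \<eta> x) = f (h \<eta>' x)" if "x \<in> ?O" for x using that h(2) \<eta> by auto
      show "deriv f (h \<eta> x) \<noteq> 0" if "x \<in> ?O" for x
        using that \<eta> h(2) \<epsilon>(2) pR by (intro deriv_nz) (auto simp: subset_iff)
    qed (use u w in auto)
  qed
  obtain g' where g': "g' holomorphic_on (\<Union>\<eta>\<in>?C. ball \<eta> (\<epsilon> \<eta>))"
      "\<And>\<eta> x. \<eta> \<in> ?C \<Longrightarrow> x \<in> ball \<eta> (\<epsilon> \<eta>) \<Longrightarrow> g' x = h \<eta> x"
  proof (rule holomorphic_glue[of ?C "\<lambda>\<eta>. ball \<eta> (\<epsilon> \<eta>)" h])
    show "h i x = h j x" if "i \<in> ?C" "j \<in> ?C" "x \<in> ball i (\<epsilon> i)" "x \<in> ball j (\<epsilon> j)" for i j x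
      using agree that by blast
  qed (use h(1) in auto)
  obtain e where e: "0 < e" "(\<Union>x\<in>?C. ball x e) \<subseteq> (\<Union>\<eta>\<in>?C. ball \<eta> (\<epsilon> \<eta>))"
  proof (rule compact_subset_open_imp_ball_epsilon_subset[OF compact_cball[of 0 s], of "\<Union>\<eta>\<in>?C. ball \<eta> (\<epsilon> \<eta>)"])
    show "?C \<subseteq> (\<Union>\<eta>\<in>?C. ball \<eta> (\<epsilon> \<eta>))" using \<epsilon>(1) by (intro subsetI UN_I) auto
  qed auto
  define s' where "s' = min 1 (s + e)"
  have sub: "ball 0 s' \<subseteq> (\<Union>x\<in>?C. ball x e)"
  proof
    fix u :: complex assume u: "u \<in> ball 0 s'"
    show "u \<in> (\<Union>x\<in>?C. ball x e)"
    proof (cases "norm u \<le> s")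
      case True then show ?thesis using e by (intro UN_I[of u]) auto
    next
      case False
      then have u0: "norm u > 0" using s by linarith
      \<comment> \<open>The radial projection of \<open>u\<close> to the circle of radius
        \<open>s\<close>; its distance from \<open>u\<close> is \<open>norm u - s\<close>.\<close>
      let ?x = "of_real (s / norm u) * u"
      have "norm ?x = s" using u0 s by (simp add: norm_mult norm_divide)
      moreover have "dist ?x u < e"
      proof -
        have "?x - u = of_real (s / norm u - 1) * u" by (simp add: algebra_simps)
        then have "dist ?x u = \<bar>s / norm u - 1\<bar> * norm u" by (simp add: dist_norm norm_mult del: of_real_diff of_real_divide)
        also have "\<dots> = norm u - s" using u0 False by (simp add: field_simps abs_if)
        also have "\<dots> < e" using u by (auto simp: s'_def)
        finally show ?thesis .
      qed
      ultimately show ?thesis by (intro UN_I[of ?x]) auto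
    qed
  qed
  note sub' = subset_trans[OF sub e(2)]
  show thesis
  proof (rule that[of s' g'])
    show "s < s'" "s' \<le> 1" using s e by (auto simp: s'_def)
    show "g' holomorphic_on ball 0 s'" using holomorphic_on_subset[OF g'(1) sub'] .
    show "f (g' u) = p u" if "u \<in> ball 0 s'" for u
    proof -
      obtain \<eta> where "\<eta> \<in> ?C" "u \<in> ball \<eta> (\<epsilon> \<eta>)" using subsetD[OF sub' \<open>u \<in> ball 0 s'\<close>] by blast
      then show ?thesis using g'(2) h(2) by simp
    qed
    have "0 \<in> ?C" "0 \<in> ball (0::complex) (\<epsilon> 0)" using s \<epsilon>(1)[of 0] by auto
    then show "g' 0 = g 0" using g'(2)[of 0 0] h(3)[of 0 0] s by simp
  qed
qed

text \<open>A continuation argument: lifts on concentric discs agree, so there is one on the disc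
  whose radius is the supremum \<open>s\<close> of the admissible radii. By
  \<open>lift_extend\<close>, \<open>s < 1\<close> would contradict the choice of
  \<open>s\<close>.\<close>

lemma ball_lift:
  assumes p: "p holomorphic_on ball 0 1"
    and pR: "\<And>u. u \<in> ball 0 1 \<Longrightarrow> R < norm (p u)" and z: "f z = p 0"
  obtains g where "g holomorphic_on ball (0::complex) 1" "\<And>u. u \<in> ball 0 1 \<Longrightarrow> f (g u) = p u" "g 0 = z"
proof -
  have cp: "continuous_on (ball 0 1) p" using p holomorphic_on_imp_continuous_on by blast
  define L where "L s g \<longleftrightarrow> g holomorphic_on ball 0 s \<and> (\<forall>u\<in>ball 0 s. f (g u) = p u) \<and> g 0 = z" for s g
  define E where "E = {s. 0 < s \<and> s \<le> 1 \<and> (\<exists>g. L s g)}"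
  have agree: "g u = g' u" if g: "L s g" "L s' g'" and s: "s \<in> E" "s' \<in> E"
    and u: "u \<in> ball 0 s" "u \<in> ball 0 s'" for g g' s s' u
  proof (rule lift_unique[OF holo, of "ball 0 s \<inter> ball 0 s'" g g' 0])
    show "connected (ball (0::complex) s \<inter> ball 0 s')" by (intro convex_connected convex_Int convex_ball)
    show "continuous_on (ball 0 s \<inter> ball 0 s') g" "continuous_on (ball 0 s \<inter> ball 0 s') g'"
      using g holomorphic_on_imp_continuous_on continuous_on_subset
      unfolding L_def by (metis inf_le1 inf_le2)+
    show "deriv f (g x) \<noteq> 0" if "x \<in> ball 0 s \<inter> ball 0 s'" for x
      using that g s pR by (intro deriv_nz) (auto simp: L_def E_def)
  qed (use g s u in \<open>auto simp: L_def E_def\<close>)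
  have bdd: "bdd_above E" unfolding E_def by (auto intro: bdd_aboveI[where M = 1])
  have "deriv f z \<noteq> 0" using deriv_nz z pR[of 0] by simp
  then obtain N k r where N: "open N" "f z \<in> N" "k holomorphic_on N" "\<And>y. y \<in> N \<Longrightarrow> f (k y) = y"
    "0 < r" "\<And>y. y \<in> ball z r \<Longrightarrow> f y \<in> N \<and> k (f y) = y"
    using holomorphic_local_inverse[OF holo] by blast
  have "open (ball 0 1 \<inter> p -` N)"
    using continuous_open_preimage[OF cp open_ball N(1)] .
  then obtain \<epsilon> where \<epsilon>: "0 < \<epsilon>" "ball 0 \<epsilon> \<subseteq> ball 0 1 \<inter> p -` N"
    using N(2) z open_contains_ball[THEN iffD1, rule_format, of "ball 0 1 \<inter> p -` N"]
    by (metis IntI vimageI centre_in_ball zero_less_one)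
  have sub: "ball 0 (min \<epsilon> 1) \<subseteq> ball 0 1 \<inter> p -` N" using \<epsilon>(2) by (auto simp: subset_iff)
  have "k \<circ> p holomorphic_on ball 0 (min \<epsilon> 1)"
    by (rule holomorphic_on_compose_gen[OF _ N(3)]) (use sub p holomorphic_on_subset in auto)
  moreover have "f ((k \<circ> p) u) = p u" if "u \<in> ball 0 (min \<epsilon> 1)" for u
    using that sub N(4) by auto
  moreover have "(k \<circ> p) 0 = z" using N(5) N(6)[of z] z by simp
  ultimately have "L (min \<epsilon> 1) (k \<circ> p)" unfolding L_def by blast
  then have "min \<epsilon> 1 \<in> E" using \<epsilon> unfolding E_def by auto
  then have Ene: "E \<noteq> {}" by blast
  define s where "s = Sup E"
  have s1: "s \<le> 1" unfolding s_def by (rule cSup_least[OF Ene]) (auto simp: E_def)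
  have s0: "0 < s" using cSup_upper[OF \<open>min \<epsilon> 1 \<in> E\<close> bdd] \<epsilon> by (simp add: s_def min_def split: if_splits)
  obtain h where h: "\<And>r. r \<in> E \<Longrightarrow> L r (h r)" 
  proof -
    have "\<forall>r\<in>E. \<exists>g. L r g" by (auto simp: E_def)
    then show thesis using that by metis
  qed
  obtain g where g: "g holomorphic_on (\<Union>r\<in>E. ball 0 r)" "\<And>r x. r \<in> E \<Longrightarrow> x \<in> ball 0 r \<Longrightarrow> g x = h r x"
  proof (rule holomorphic_glue[of E "ball 0" h])
    show "h i x = h j x" if "i \<in> E" "j \<in> E" "x \<in> ball 0 i" "x \<in> ball 0 j" for i j x
      using agree[OF h h] that by blast
    show "h i holomorphic_on ball 0 i" if "i \<in> E" for i using h[OF that] by (simp add: L_def)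
  qed auto
  have U: "ball 0 s \<subseteq> (\<Union>r\<in>E. ball 0 r)"
    using less_cSup_iff[OF Ene bdd] by (auto simp: s_def)
  have L: "L s g" unfolding L_def
  proof (intro conjI ballI)
    show "g holomorphic_on ball 0 s" using g(1) U holomorphic_on_subset by blast
    show "f (g u) = p u" if u: "u \<in> ball 0 s" for u
    proof -
      obtain r where "r \<in> E" "u \<in> ball 0 r" using u U by blast
      then show ?thesis using g(2) h by (simp add: L_def)
    qed
    show "g 0 = z" using g(2)[of _ 0, OF \<open>min \<epsilon> 1 \<in> E\<close>] h[OF \<open>min \<epsilon> 1 \<in> E\<close>] \<epsilon> by (simp add: L_def)
  qed
  have "s = 1"
  proof (rule ccontr)
    assume "s \<noteq> 1"
    then have "s < 1" using s1 by simp
    then obtain s' g' where "s < s'" "s' \<le> 1" "g' holomorphic_on ball 0 s'"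
      "\<And>u. u \<in> ball 0 s' \<Longrightarrow> f (g' u) = p u" "g' 0 = g 0"
      using lift_extend[OF p pR s0 _ ] L unfolding L_def by metis
    then have "s' \<in> E" using L s0 unfolding E_def L_def by force
    then show False using cSup_upper[OF _ bdd] \<open>s < s'\<close> by (force simp: s_def)
  qed
  then show thesis using L that unfolding L_def by blast
qed

subsection \<open>Logarithmic coordinates\<close>

definition H :: "complex set" where "H = {\<zeta>. ln R < Re \<zeta>}"

definition exp_lift :: "(complex \<Rightarrow> complex) \<Rightarrow> bool" where
  "exp_lift g \<longleftrightarrow> g holomorphic_on H \<and> (\<forall>\<zeta>\<in>H. f (g \<zeta>) = exp \<zeta>)"

lemma open_H: "open H"
  unfolding H_def by (rule open_halfspace_Re_gt)

lemma convex_H: "convex H"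
  unfolding H_def by (rule convex_halfspace_Re_gt)

lemma exp_H_iff: "R < norm (exp \<zeta>) \<longleftrightarrow> \<zeta> \<in> H"
proof -
  have "exp (ln R) < exp (Re \<zeta>) \<longleftrightarrow> ln R < Re \<zeta>" by (rule exp_less_cancel_iff)
  then show ?thesis using R_pos by (simp add: H_def)
qed

text \<open>This carries \<open>ball_lift\<close> from the disc to \<open>H\<close>:
  \<open>m\<close> is the Moebius map of the unit disc onto \<open>H\<close> taking 0 to
  \<open>\<zeta>\<^sub>0\<close>, and \<open>q\<close> is its inverse. Here \<open>b\<close> is the
  boundary point of \<open>H\<close> level with \<open>\<zeta>\<^sub>0\<close>, and \<open>x\<close>
  is the distance between the two.\<close>

lemma exp_lift_exists:
  assumes \<zeta>: "\<zeta>\<^sub>0 \<in> H" and z: "f z = exp \<zeta>\<^sub>0"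
  obtains g where "exp_lift g" "g \<zeta>\<^sub>0 = z"
proof -
  define x where "x = Re \<zeta>\<^sub>0 - ln R"
  define b where "b = Complex (ln R) (Im \<zeta>\<^sub>0)"
  have x: "0 < x" using \<zeta> by (simp add: x_def H_def)
  have bx: "b + of_real x = \<zeta>\<^sub>0" by (simp add: b_def x_def complex_eq_iff)
  define m where "m u = b + of_real x * ((1 + u) / (1 - u))" for u
  define q where "q \<zeta> = (\<zeta> - b - of_real x) / (\<zeta> - b + of_real x)" for \<zeta>
  have u1: "1 - u \<noteq> 0" if "u \<in> ball 0 1" for u :: complex
    using that by auto
  have mH: "m u \<in> H" if u: "u \<in> ball 0 1" for u
  proof -
    have "(cmod u)\<^sup>2 < 1\<^sup>2" using u by (intro power_strict_mono) auto
    \<comment> \<open>The real part equals \<open>1 - (cmod u)\<^sup>2\<close>.\<close>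
    then have "0 < Re ((1 + u) * cnj (1 - u))"
      unfolding cmod_power2 by (simp add: power2_eq_square algebra_simps)
    then have "0 < x * Re ((1 + u) / (1 - u))"
      using x Re_complex_div_gt_0 by (intro mult_pos_pos) auto
    also have "\<dots> = Re (of_real x * ((1 + u) / (1 - u)))" unfolding times_complex.sel by simp
    finally show ?thesis unfolding m_def H_def b_def by (simp del: times_divide_eq_right)
  qed
  have den: "\<zeta> - b + of_real x \<noteq> 0" if "\<zeta> \<in> H" for \<zeta>
    using that x by (auto simp: H_def b_def complex_eq_iff)
  have q1: "q \<zeta> \<in> ball 0 1" if h: "\<zeta> \<in> H" for \<zeta>
  proof -
    have "0 < Re (\<zeta> - b)" using h by (simp add: H_def b_def)
    then have "0 < x * Re (\<zeta> - b)" using x by simp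
    then have "(cmod (\<zeta> - b - of_real x))\<^sup>2 < (cmod (\<zeta> - b + of_real x))\<^sup>2"
      unfolding cmod_power2 by (simp add: power2_eq_square algebra_simps)
    then have "cmod (\<zeta> - b - of_real x) < cmod (\<zeta> - b + of_real x)"
      by (rule power_less_imp_less_base) simp
    then show ?thesis using den[OF h] by (simp add: q_def norm_divide)
  qed
  have mq: "m (q \<zeta>) = \<zeta>" if h: "\<zeta> \<in> H" for \<zeta>
  proof -
    have "1 + q \<zeta> = (2 * (\<zeta> - b)) / (\<zeta> - b + of_real x)" "1 - q \<zeta> = 2 * of_real x / (\<zeta> - b + of_real x)"
      using den[OF h] by (simp_all add: q_def field_simps)
    then have "(1 + q \<zeta>) / (1 - q \<zeta>) = (2 * (\<zeta> - b)) / (2 * of_real x)"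
      using den[OF h] x by simp
    also have "\<dots> = (\<zeta> - b) / of_real x" using x by (simp add: field_simps)
    finally show ?thesis using x by (simp add: m_def)
  qed
  define p where "p = exp \<circ> m"
  have "m holomorphic_on ball 0 1"
    unfolding m_def using u1 by (intro holomorphic_intros) auto
  then have p: "p holomorphic_on ball 0 1"
    unfolding p_def by (intro holomorphic_on_compose holomorphic_on_exp)
  have pR: "R < norm (p u)" if "u \<in> ball 0 1" for u
    unfolding p_def o_def exp_H_iff using mH[OF that] .
  have m0: "m 0 = \<zeta>\<^sub>0" using bx by (simp add: m_def)
  obtain g where g: "g holomorphic_on ball 0 1" "\<And>u. u \<in> ball 0 1 \<Longrightarrow> f (g u) = p u" "g 0 = z"
    using ball_lift[OF p pR, of z] z m0 by (auto simp: p_def)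
  have "q holomorphic_on H"
    unfolding q_def using den by (intro holomorphic_intros) auto
  then have "g \<circ> q holomorphic_on H"
    by (rule holomorphic_on_compose_gen[OF _ g(1)]) (use q1 in blast)
  moreover have "f ((g \<circ> q) \<zeta>) = exp \<zeta>" if "\<zeta> \<in> H" for \<zeta>
    using g(2)[OF q1[OF that]] mq[OF that] by (simp add: p_def)
  ultimately have "exp_lift (g \<circ> q)" unfolding exp_lift_def by blast
  moreover have "(g \<circ> q) \<zeta>\<^sub>0 = z" using bx g(3) by (simp add: q_def algebra_simps)
  ultimately show thesis using that by blast
qed

lemma exp_lift_unique:
  assumes g: "exp_lift g" "exp_lift g'" and a: "a \<in> H" "g a = g' a" and \<zeta>: "\<zeta> \<in> H"
  shows "g \<zeta> = g' \<zeta>"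
proof (rule lift_unique[OF holo convex_connected[OF convex_H], of g g' a])
  show "continuous_on H g" "continuous_on H g'"
    using g by (auto simp: exp_lift_def holomorphic_on_imp_continuous_on)
  show "f (g x) = f (g' x)" if "x \<in> H" for x using that g by (simp add: exp_lift_def)
  show "deriv f (g x) \<noteq> 0" if "x \<in> H" for x
    using that g exp_H_iff[of x] by (intro deriv_nz) (simp add: exp_lift_def)
qed (use a \<zeta> in auto)

text \<open>Points at which two lifts take the same value have equal exponentials, so a shift by a
  period moves one point to the other and \<open>exp_lift_unique\<close> becomes applicable.\<close>

lemma exp_lift_shift:
  assumes "exp_lift g"
  shows "exp_lift (\<lambda>\<zeta>. g (\<zeta> + of_int (2 * n) * pi * \<i>))"
proof -
  have "(g \<circ> (\<lambda>\<zeta>. \<zeta> + of_int (2 * n) * pi * \<i>)) holomorphic_on H"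
    using assms unfolding exp_lift_def
    by (intro holomorphic_on_compose_gen[where t = H and g = g] holomorphic_intros) (auto simp: H_def)
  moreover have "exp (\<zeta> + of_int (2 * n) * pi * \<i>) = exp \<zeta>" for \<zeta>
    unfolding exp_eq by blast
  moreover have "\<zeta> + of_int (2 * n) * pi * \<i> \<in> H" if "\<zeta> \<in> H" for \<zeta>
    using that by (simp add: H_def)
  ultimately show ?thesis using assms unfolding exp_lift_def by (simp add: o_def)
qed

section \<open>Injectivity of the lifts and the branch of the logarithm\<close>

text \<open>Otherwise \<open>f\<close> would have a pole at infinity, which forces an entire
  function to be a polynomial.\<close>

lemma not_filterlim_infinity: "\<not> filterlim f at_infinity at_infinity"
proof
  assume "filterlim f at_infinity at_infinity"
  then have "((inverse \<circ> f) \<longlongrightarrow> 0) at_infinity"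
    unfolding o_def by (rule filterlim_compose[OF tendsto_inverse_0])
  then obtain a n where a: "\<And>z. f z = (\<Sum>i\<le>n. a i * z ^ i)"
    using pole_at_infinity[OF holo] by metis
  have "f z = poly (\<Sum>i\<le>n. monom (a i) i) z" for z
    by (simp add: a poly_sum poly_monom)
  then show False using not_poly by blast
qed

text \<open>Moving points into a strip of height \<open>T\<close> makes sets with bounded real parts
  relatively compact, which gives the closedness and boundedness of images under a periodic
  lift.\<close>

lemma periodic_image:
  assumes T: "0 < T" and per: "\<And>\<zeta>. \<zeta> \<in> H \<Longrightarrow> g (\<zeta> + \<i> * of_real T) = g \<zeta>"
    and \<zeta>: "\<zeta> \<in> H"
  obtains \<zeta>' where "g \<zeta>' = g \<zeta>" "Re \<zeta>' = Re \<zeta>" "0 \<le> Im \<zeta>'" "Im \<zeta>' \<le> T"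
proof -
  have nat: "g (\<zeta> + of_nat k * (\<i> * of_real T)) = g \<zeta>" if "\<zeta> \<in> H" for k \<zeta>
  proof (induction k)
    case (Suc k)
    have "\<zeta> + of_nat k * (\<i> * of_real T) \<in> H" using that by (simp add: H_def)
    from per[OF this] Suc show ?case by (simp add: algebra_simps)
  qed simp
  define k where "k = \<lfloor>Im \<zeta> / T\<rfloor>"
  define \<zeta>' where "\<zeta>' = \<zeta> - of_int k * (\<i> * of_real T)"
  have \<zeta>'H: "\<zeta>' \<in> H" using \<zeta> by (simp add: H_def \<zeta>'_def)
  have "g \<zeta>' = g \<zeta>"
  proof (cases "k \<ge> 0")
    case True
    then have "\<zeta> = \<zeta>' + of_nat (nat k) * (\<i> * of_real T)" by (simp add: \<zeta>'_def)
    then show ?thesis using nat[OF \<zeta>'H] by metis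
  next
    case False
    then have "\<zeta>' = \<zeta> + of_nat (nat (- k)) * (\<i> * of_real T)" by (simp add: \<zeta>'_def)
    then show ?thesis using nat[OF \<zeta>] by metis
  qed
  moreover have "of_int k \<le> Im \<zeta> / T" "Im \<zeta> / T < of_int k + 1"
    unfolding k_def by linarith+
  then have "of_int k * T \<le> Im \<zeta>" "Im \<zeta> < of_int k * T + T"
    using T by (simp_all add: field_simps)
  then have "0 \<le> Im \<zeta>'" "Im \<zeta>' \<le> T" by (simp_all add: \<zeta>'_def)
  moreover have "Re \<zeta>' = Re \<zeta>" by (simp add: \<zeta>'_def)
  ultimately show thesis using that by blast
qed

text \<open>A periodic lift would make \<open>f\<close> proper near infinity: the image of a half-plane under the lift
  has compact boundary, so it contains a neighbourhood of infinity, on which \<open>f\<close> is large.\<close>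

lemma exp_lift_not_periodic:
  assumes g: "exp_lift g" and T: "0 < T" and per: "\<And>\<zeta>. \<zeta> \<in> H \<Longrightarrow> g (\<zeta> + \<i> * of_real T) = g \<zeta>"
  shows False
proof -
  have contg: "continuous_on H g" and fg: "\<And>\<zeta>. \<zeta> \<in> H \<Longrightarrow> f (g \<zeta>) = exp \<zeta>"
    using g by (auto simp: exp_lift_def holomorphic_on_imp_continuous_on)
  have "\<exists>M. \<forall>z. M < norm z \<longrightarrow> K \<le> norm (f z)" for K
  proof -
    \<comment> \<open>Being above \<open>ln R\<close>, \<open>c\<close> puts the closed half-plane
      \<open>c \<le> Re \<zeta>\<close> inside \<open>H\<close>; being above \<open>K\<close>, it
      gives \<open>K \<le> exp c\<close>.\<close>
    define c where "c = max (ln R) K + 1"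
    have "K \<le> exp c" using exp_ge_add_one_self[of c] by (simp add: c_def)
    define P where "P = {\<zeta>. c < Re \<zeta>}"
    have PH: "P \<subseteq> H" by (auto simp: P_def H_def c_def)
    have "open P" unfolding P_def by (rule open_halfspace_Re_gt)
    have "\<not> g constant_on H"
    proof
      assume "g constant_on H"
      then obtain w where w: "\<And>\<zeta>. \<zeta> \<in> H \<Longrightarrow> g \<zeta> = w" unfolding constant_on_def by blast
      have "of_real c \<in> H" "of_real (c + 1) \<in> H" by (auto simp: H_def c_def)
      then have "exp (complex_of_real c) = exp (complex_of_real (c + 1))" using fg w by metis
      then have "exp c = exp (c + 1)" by (metis norm_exp_eq_Re Re_complex_of_real)
      then show False by simp
    qed
    then have "open (g ` P)"
      using g open_mapping_thm[OF _ open_H convex_connected[OF convex_H] \<open>open P\<close> PH]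
      by (simp add: exp_lift_def)
    define Q where "Q = g ` {\<zeta>. c \<le> Re \<zeta>}"
    define \<Gamma> where "\<Gamma> = g ` {\<zeta>. Re \<zeta> = c}"
    have cH: "{\<zeta>. c \<le> Re \<zeta>} \<subseteq> H" by (auto simp: H_def c_def)
    have box: "\<exists>\<zeta>'. g \<zeta>' = g \<zeta> \<and> Re \<zeta>' = Re \<zeta> \<and> 0 \<le> Im \<zeta>' \<and> Im \<zeta>' \<le> T" if "\<zeta> \<in> H" for \<zeta>
      using periodic_image[of T g, OF T per that] by metis
    \<comment> \<open>The preimages of a convergent sequence can be taken in a compact box:
      periodicity bounds their imaginary parts, and
      \<open>norm (f (g \<zeta>)) = exp (Re \<zeta>)\<close> bounds their real parts.\<close>
    have "closed Q"
      unfolding closed_sequential_limits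
    proof (intro allI impI, elim conjE)
      fix z l assume z: "\<forall>n. z n \<in> Q" and lim: "z \<longlonglongrightarrow> l"
      have "\<exists>\<zeta>. z n = g \<zeta> \<and> c \<le> Re \<zeta> \<and> 0 \<le> Im \<zeta> \<and> Im \<zeta> \<le> T" for n
        using z[rule_format, of n] box cH unfolding Q_def by (smt (verit) imageE mem_Collect_eq subsetD)
      then obtain \<zeta> where \<zeta>: "\<And>n. z n = g (\<zeta> n)" "\<And>n. c \<le> Re (\<zeta> n)" "\<And>n. 0 \<le> Im (\<zeta> n)" "\<And>n. Im (\<zeta> n) \<le> T"
        by metis
      have \<zeta>H: "\<zeta> n \<in> H" for n using \<zeta>(2) cH by auto
      have "(\<lambda>n. f (z n)) \<longlonglongrightarrow> f l"
        using cont[of UNIV] lim continuous_on_tendsto_compose[of UNIV f z l] by simp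
      then have "Bseq (\<lambda>n. f (z n))" by (intro convergent_imp_Bseq convergentI)
      then obtain B where B: "0 < B" "\<And>n. norm (f (z n)) \<le> B" by (auto simp: Bseq_def)
      have "Re (\<zeta> n) \<le> ln B" for n
        using B(2)[of n] fg[OF \<zeta>H] B(1) \<zeta>(1) by (simp add: ln_ge_iff)
      then have "\<zeta> n \<in> cbox (Complex c 0) (Complex (ln B) T)" for n
        using \<zeta> by (simp add: in_cbox_complex_iff)
      then obtain \<zeta>\<^sub>0 \<sigma> where \<sigma>: "\<zeta>\<^sub>0 \<in> cbox (Complex c 0) (Complex (ln B) T)" "strict_mono (\<sigma> :: nat \<Rightarrow> nat)"
        "(\<zeta> \<circ> \<sigma>) \<longlonglongrightarrow> \<zeta>\<^sub>0"
        using compact_cbox unfolding compact_def by metis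
      have c0: "c \<le> Re \<zeta>\<^sub>0" using \<sigma>(1) by (simp add: in_cbox_complex_iff)
      then have \<zeta>0H: "\<zeta>\<^sub>0 \<in> H" using cH by auto
      have "(\<lambda>n. g ((\<zeta> \<circ> \<sigma>) n)) \<longlonglongrightarrow> g \<zeta>\<^sub>0"
        using continuous_on_tendsto_compose[OF contg \<sigma>(3) \<zeta>0H] \<zeta>H by simp
      moreover have "(\<lambda>n. g ((\<zeta> \<circ> \<sigma>) n)) \<longlonglongrightarrow> l"
        using LIMSEQ_subseq_LIMSEQ[OF lim \<sigma>(2)] \<zeta>(1) by (simp add: o_def)
      ultimately have "l = g \<zeta>\<^sub>0" using LIMSEQ_unique by blast
      then show "l \<in> Q" using c0 by (simp add: Q_def)
    qed
    have "\<Gamma> \<subseteq> g ` cbox (Complex c 0) (Complex c T)"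
    proof
      fix z assume "z \<in> \<Gamma>"
      then obtain \<zeta> where \<zeta>: "z = g \<zeta>" "Re \<zeta> = c" by (auto simp: \<Gamma>_def)
      then have "\<zeta> \<in> H" using cH by auto
      from box[OF this] obtain \<zeta>' where "g \<zeta>' = g \<zeta>" "Re \<zeta>' = Re \<zeta>" "0 \<le> Im \<zeta>'" "Im \<zeta>' \<le> T"
        by blast
      with \<zeta> show "z \<in> g ` cbox (Complex c 0) (Complex c T)"
        by (intro image_eqI[of _ _ \<zeta>']) (auto simp: in_cbox_complex_iff)
    qed
    moreover have "cbox (Complex c 0) (Complex c T) \<subseteq> H"
      using cH by (auto simp: in_cbox_complex_iff)
    then have "bounded (g ` cbox (Complex c 0) (Complex c T))"
      by (intro compact_imp_bounded compact_continuous_image continuous_on_subset[OF contg]) auto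
    ultimately have "bounded \<Gamma>" using bounded_subset by blast
    then obtain M where M: "\<And>z. z \<in> \<Gamma> \<Longrightarrow> norm z \<le> M" unfolding bounded_iff by blast
    let ?S = "- cball (0::complex) M"
    have con: "connected ?S" by (intro connected_complement_bounded_convex) auto
    have "{\<zeta>. c \<le> Re \<zeta>} = P \<union> {\<zeta>. Re \<zeta> = c}" by (auto simp: P_def)
    then have QP: "Q = g ` P \<union> \<Gamma>" by (simp add: Q_def \<Gamma>_def image_Un)
    have eq: "?S \<inter> g ` P = ?S \<inter> Q" using M unfolding QP by auto
    have "openin (top_of_set ?S) (?S \<inter> g ` P)" using \<open>open (g ` P)\<close> by (rule openin_open_Int)
    moreover have "closedin (top_of_set ?S) (?S \<inter> g ` P)"
      unfolding eq using \<open>closed Q\<close> by (rule closedin_closed_Int)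
    ultimately have "?S \<inter> g ` P = {} \<or> ?S \<inter> g ` P = ?S"
      using con unfolding connected_clopen by blast
    moreover have "?S \<inter> g ` P \<noteq> {}"
    proof
      assume "?S \<inter> g ` P = {}"
      then have sub: "g ` P \<subseteq> cball 0 M" by auto
      have "bounded (f ` cball 0 M)"
        by (intro compact_imp_bounded compact_continuous_image cont) auto
      then obtain B where B: "\<And>z. z \<in> cball 0 M \<Longrightarrow> norm (f z) \<le> B" unfolding bounded_iff by blast
      define d where "d = max c B + 1"
      have "of_real d \<in> P" by (simp add: P_def d_def)
      then have "norm (exp (complex_of_real d)) \<le> B" using B[of "g (of_real d)"] sub fg PH by force
      then have "exp d \<le> B" by simp
      moreover have "d + 1 \<le> exp d" using exp_ge_add_one_self[of d] by (simp add: add.commute)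
      ultimately show False by (simp add: d_def)
    qed
    ultimately have sub: "?S \<subseteq> g ` P" by blast
    have "K \<le> norm (f z)" if "M < norm z" for z
    proof -
      have "z \<in> g ` P" using that sub by auto
      then obtain \<zeta> where \<zeta>: "\<zeta> \<in> P" "z = g \<zeta>" by blast
      have "K \<le> exp c" by fact
      also have "\<dots> \<le> exp (Re \<zeta>)" using \<zeta> by (simp add: P_def)
      also have "\<dots> = norm (f z)" using \<zeta> fg PH by auto
      finally show ?thesis .
    qed
    then show ?thesis by blast
  qed
  then have "filterlim f at_infinity at_infinity"
    unfolding filterlim_at_infinity[OF order_refl] eventually_at_infinity
    by (meson gt_ex less_le_trans)
  with not_filterlim_infinity show False by blast
qed

text \<open>Two points with the same value differ by a period of \<open>exp\<close>. By uniqueness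
  \<open>g\<close> equals its own shift by that period, so \<open>g\<close> would be
  periodic.\<close>

lemma exp_lift_inj:
  assumes g: "exp_lift g"
  shows "inj_on g H"
proof (rule inj_onI, rule ccontr)
  fix a b assume a: "a \<in> H" and b: "b \<in> H" and eq: "g a = g b" and ne: "a \<noteq> b"
  have "exp a = exp b" using g a b eq unfolding exp_lift_def by metis
  then obtain n :: int where n: "a = b + (of_int (2 * n) * pi) * \<i>" unfolding exp_eq by blast
  have n0: "n \<noteq> 0" using n ne by auto
  have per: "g (\<zeta> + of_int (2 * n) * pi * \<i>) = g \<zeta>" if "\<zeta> \<in> H" for \<zeta>
    using exp_lift_unique[OF exp_lift_shift[OF g] g b _ that] n eq by simp
  define T where "T = 2 * pi * \<bar>of_int n\<bar>"
  have T: "0 < T" using n0 by (simp add: T_def)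
  have "g (\<zeta> + \<i> * of_real T) = g \<zeta>" if "\<zeta> \<in> H" for \<zeta>
  proof (cases "n \<ge> 0")
    case True
    then show ?thesis using per[OF that] by (simp add: T_def algebra_simps)
  next
    case False
    have "\<zeta> + \<i> * of_real T \<in> H" using that by (simp add: H_def)
    then show ?thesis using per[of "\<zeta> + \<i> * of_real T"] False by (simp add: T_def algebra_simps)
  qed
  then show False using exp_lift_not_periodic[OF g T] by blast
qed

text \<open>If \<open>g a = g' b\<close>, then \<open>b - a\<close> is a period of
  \<open>exp\<close> and \<open>g\<close> is a shift of \<open>g'\<close>; vertical shifts preserve
  \<open>H\<close>.\<close>

lemma exp_lift_images:
  assumes g: "exp_lift g" "exp_lift g'" and meet: "g ` H \<inter> g' ` H \<noteq> {}"
  shows "g ` H = g' ` H"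
proof -
  have sub: "g ` H \<subseteq> g' ` H" if g: "exp_lift g" "exp_lift g'" and meet: "g ` H \<inter> g' ` H \<noteq> {}" for g g'
  proof -
    obtain a b where ab: "a \<in> H" "b \<in> H" "g a = g' b" using meet by blast
    have "exp a = exp b" using g ab unfolding exp_lift_def by metis
    then obtain n :: int where n: "b = a + of_int (2 * n) * pi * \<i>"
      using exp_eq[of b a] by auto
    have "g \<zeta> = g' (\<zeta> + of_int (2 * n) * pi * \<i>)" if "\<zeta> \<in> H" for \<zeta>
      using exp_lift_unique[OF g(1) exp_lift_shift[OF g(2), of n] ab(1) _ that] ab(3) n by simp
    moreover have "\<zeta> + of_int (2 * n) * pi * \<i> \<in> H" if "\<zeta> \<in> H" for \<zeta>
      using that by (simp add: H_def)
    ultimately show ?thesis by blast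
  qed
  show ?thesis using sub[OF g meet] sub[OF g(2,1)] meet by blast
qed

text \<open>The sets \<open>g ` H\<close> are the tracts of \<open>f\<close>; they partition \<open>{z. R < norm (f z)}\<close>, and each is
  mapped to \<open>H\<close> by a branch of \<open>ln \<circ> f\<close>.\<close>

lemma log_branch_exists:
  obtains \<phi> where "continuous_on {z. R < norm (f z)} \<phi>"
    "\<And>z. R < norm (f z) \<Longrightarrow> \<phi> z \<in> H \<and> exp (\<phi> z) = f z"
    "\<And>z. R < norm (f z) \<Longrightarrow> \<exists>g. exp_lift g \<and> g (\<phi> z) = z \<and> (\<forall>\<zeta>\<in>H. \<phi> (g \<zeta>) = \<zeta>)"
proof -
  define \<T> where "\<T> = {g ` H | g. exp_lift g}"
  have cover: "\<exists>T\<in>\<T>. z \<in> T" if z: "R < norm (f z)" for z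
  proof -
    have "f z \<noteq> 0" using z R_pos by auto
    then obtain w where w: "exp w = f z" using exp_Ln by blast
    then have "w \<in> H" using exp_H_iff z by metis
    from exp_lift_exists[OF this] w obtain g where "exp_lift g" "g w = z" by metis
    then show ?thesis using \<open>w \<in> H\<close> unfolding \<T>_def by blast
  qed
  have uniq: "T = T'" if "T \<in> \<T>" "T' \<in> \<T>" "z \<in> T" "z \<in> T'" for T T' z
    using that exp_lift_images unfolding \<T>_def by blast
  have "\<forall>T\<in>\<T>. \<exists>g. exp_lift g \<and> T = g ` H" unfolding \<T>_def by blast
  then obtain \<gamma> where \<gamma>: "\<And>T. T \<in> \<T> \<Longrightarrow> exp_lift (\<gamma> T)" "\<And>T. T \<in> \<T> \<Longrightarrow> T = \<gamma> T ` H"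
    by metis
  \<comment> \<open>On each tract \<open>T\<close>, this is the inverse of one chosen lift
    \<open>\<gamma> T\<close>; as the tracts are disjoint and open, continuity can be checked on
    each of them.\<close>
  define \<phi> where "\<phi> z = the_inv_into H (\<gamma> (THE T. T \<in> \<T> \<and> z \<in> T)) z" for z
  have \<phi>: "\<phi> (\<gamma> T \<zeta>) = \<zeta>" if T: "T \<in> \<T>" and \<zeta>: "\<zeta> \<in> H" for T \<zeta>
  proof -
    have "\<gamma> T \<zeta> \<in> T" using \<gamma>(2)[OF T] \<zeta> by blast
    then have "(THE T'. T' \<in> \<T> \<and> \<gamma> T \<zeta> \<in> T') = T" using uniq T by (intro the_equality) blast+
    then show ?thesis
      unfolding \<phi>_def using the_inv_into_f_f[OF exp_lift_inj[OF \<gamma>(1)[OF T]] \<zeta>] by simp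
  qed
  have T: "open T \<and> continuous_on T \<phi>" if T: "T \<in> \<T>" for T
  proof -
    have hol: "\<gamma> T holomorphic_on H" using \<gamma>(1)[OF T] by (simp add: exp_lift_def)
    have inj: "inj_on (\<gamma> T) H" by (rule exp_lift_inj[OF \<gamma>(1)[OF T]])
    obtain k where k: "k holomorphic_on (\<gamma> T ` H)" "\<And>z. z \<in> H \<Longrightarrow> k (\<gamma> T z) = z"
      by (rule holomorphic_has_inverse[OF hol open_H inj]) (rule that)
    have "continuous_on (\<gamma> T ` H) k" using k(1) holomorphic_on_imp_continuous_on by blast
    moreover have "\<phi> z = k z" if "z \<in> \<gamma> T ` H" for z using that k(2) \<phi>[OF T] by auto
    ultimately have "continuous_on (\<gamma> T ` H) \<phi>" by (subst continuous_on_cong[OF refl]) auto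
    then show ?thesis using \<gamma>(2)[OF T] open_mapping_thm3[OF hol open_H inj] by simp
  qed
  have main: "\<exists>g. exp_lift g \<and> g (\<phi> z) = z \<and> \<phi> z \<in> H \<and> (\<forall>\<zeta>\<in>H. \<phi> (g \<zeta>) = \<zeta>)"
    if z: "R < norm (f z)" for z
  proof -
    obtain T where T: "T \<in> \<T>" "z \<in> T" using cover[OF z] by blast
    then obtain \<zeta> where \<zeta>: "\<zeta> \<in> H" "z = \<gamma> T \<zeta>" using \<gamma>(2) by blast
    then show ?thesis using \<gamma>(1)[OF T(1)] \<phi>[OF T(1)] by auto
  qed
  show thesis
  proof (rule that[of \<phi>])
    have "continuous_on (\<Union>T\<in>\<T>. T) \<phi>" using T by (intro continuous_on_open_UN) auto
    then show "continuous_on {z. R < norm (f z)} \<phi>"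
      by (rule continuous_on_subset) (use cover in auto)
    show "\<phi> z \<in> H \<and> exp (\<phi> z) = f z" if "R < norm (f z)" for z
      using main[OF that] unfolding exp_lift_def by metis
    show "\<exists>g. exp_lift g \<and> g (\<phi> z) = z \<and> (\<forall>\<zeta>\<in>H. \<phi> (g \<zeta>) = \<zeta>)" if "R < norm (f z)" for z
      using main[OF that] by blast
  qed
qed

section \<open>Sections in logarithmic coordinates and their contraction\<close>

text \<open>\<open>G\<close> is a right inverse of \<open>\<phi> \<circ> exp\<close>, the
  logarithmic transform of \<open>f\<close>. The equation for \<open>f\<close> places
  \<open>exp (G \<zeta>)\<close> in \<open>{z. R < norm (f z)}\<close>, where \<open>\<phi>\<close>
  is controlled.\<close>

definition log_section :: "(complex \<Rightarrow> complex) \<Rightarrow> (complex \<Rightarrow> complex) \<Rightarrow> bool" where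
  "log_section \<phi> G \<longleftrightarrow> G holomorphic_on H \<and> (\<forall>\<zeta>\<in>H. f (exp (G \<zeta>)) = exp \<zeta> \<and> \<phi> (exp (G \<zeta>)) = \<zeta>)"

text \<open>The lift \<open>g\<close> omits 0 and \<open>H\<close> is convex, so \<open>g\<close>
  has a holomorphic logarithm there; a multiple of \<open>2 * pi * \<i>\<close> adjusts it to the
  prescribed value \<open>v\<close>.\<close>

lemma log_section_exists:
  assumes g: "exp_lift g" "g (\<phi> (exp v)) = exp v" "\<And>\<zeta>. \<zeta> \<in> H \<Longrightarrow> \<phi> (g \<zeta>) = \<zeta>"
    and \<phi>: "\<phi> (exp v) \<in> H"
  obtains G where "log_section \<phi> G" "G (\<phi> (exp v)) = v"
proof -
  have hol: "g holomorphic_on H" and fg: "\<And>\<zeta>. \<zeta> \<in> H \<Longrightarrow> f (g \<zeta>) = exp \<zeta>"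
    using g(1) by (auto simp: exp_lift_def)
  have nz: "g \<zeta> \<noteq> 0" if "\<zeta> \<in> H" for \<zeta>
    using fg[OF that] norm_f_0 that exp_H_iff[of \<zeta>] by (metis not_less)
  obtain L where L: "L holomorphic_on H" "\<And>\<zeta>. \<zeta> \<in> H \<Longrightarrow> g \<zeta> = exp (L \<zeta>)"
    using contractible_imp_holomorphic_log[OF hol convex_imp_contractible[OF convex_H] nz] by metis
  have "exp v = exp (L (\<phi> (exp v)))" using L(2)[OF \<phi>] g(2) by simp
  then obtain n :: int where n: "v = L (\<phi> (exp v)) + of_int (2 * n) * pi * \<i>"
    unfolding exp_eq by blast
  define G where "G \<zeta> = L \<zeta> + of_int (2 * n) * pi * \<i>" for \<zeta>
  have "exp (G \<zeta>) = exp (L \<zeta>)" for \<zeta> unfolding exp_eq G_def by blast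
  then have eG: "exp (G \<zeta>) = g \<zeta>" if "\<zeta> \<in> H" for \<zeta> using L(2)[OF that] by simp
  have "G holomorphic_on H" unfolding G_def using L(1) by (intro holomorphic_intros)
  then have "log_section \<phi> G" using eG fg g(3) by (simp add: log_section_def)
  moreover have "G (\<phi> (exp v)) = v" using n by (simp add: G_def)
  ultimately show thesis using that by blast
qed

text \<open>Applying \<open>\<phi> \<circ> exp\<close> to a common value shows that it is taken at
  the same point. Both sections lift \<open>exp\<close> through \<open>f \<circ> exp\<close>, whose
  derivative does not vanish on their images, so \<open>lift_unique\<close> applies.\<close>

lemma log_section_unique:
  assumes G: "log_section \<phi> G" "log_section \<phi> G'" and meet: "G ` H \<inter> G' ` H \<noteq> {}" and \<zeta>: "\<zeta> \<in> H"
  shows "G \<zeta> = G' \<zeta>"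
proof -
  obtain a b where ab: "a \<in> H" "b \<in> H" "G a = G' b" using meet by blast
  then have "a = b" using G unfolding log_section_def by metis
  let ?F = "\<lambda>v. f (exp v)"
  have F: "(?F has_field_derivative deriv f (exp v) * exp v) (at v)" for v
    using holomorphic_derivI[OF holo open_UNIV] DERIV_chain2 DERIV_exp by blast
  have "f \<circ> exp holomorphic_on UNIV"
    by (rule holomorphic_on_compose[OF holomorphic_on_exp holomorphic_on_subset[OF holo]]) simp
  then have "?F holomorphic_on UNIV" by (simp add: o_def)
  then show ?thesis
  proof (rule lift_unique[OF _ convex_connected[OF convex_H], of ?F G G' a])
    show "continuous_on H G" "continuous_on H G'"
      using G by (auto simp: log_section_def holomorphic_on_imp_continuous_on)
    show "f (exp (G x)) = f (exp (G' x))" if "x \<in> H" for x using that G by (simp add: log_section_def)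
    show "deriv ?F (G x) \<noteq> 0" if "x \<in> H" for x
      using that G exp_H_iff[of x] deriv_nz[of "exp (G x)"] DERIV_imp_deriv[OF F, of "G x"]
      by (simp add: log_section_def)
  qed (use ab \<open>a = b\<close> \<zeta> in auto)
qed

lemma log_section_inj: "log_section \<phi> G \<Longrightarrow> inj_on G H"
  unfolding log_section_def inj_on_def by metis

lemma log_section_open:
  assumes "log_section \<phi> G"
  shows "open (G ` H)"
  using open_mapping_thm3[OF _ open_H log_section_inj[OF assms]] assms by (simp add: log_section_def)

text \<open>By periodicity of \<open>exp\<close>, the image of a section contains no two points differing by \<open>2 * pi * \<i>\<close>, hence no
  disc of radius larger than \<open>pi\<close>; Bloch's theorem turns this into a derivative bound.\<close>

lemma log_section_deriv:
  assumes G: "log_section \<phi> G" and \<zeta>: "ln R + 48 * pi \<le> Re \<zeta>"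
  shows "norm (deriv G \<zeta>) \<le> 1 / 4"
proof (rule ccontr)
  assume less: "\<not> norm (deriv G \<zeta>) \<le> 1 / 4"
  define t where "t = Re \<zeta> - ln R"
  define r where "r = t * norm (deriv G \<zeta>) / 12"
  have t: "48 * pi \<le> t" "0 < t" using \<zeta> pi_gt_zero by (auto simp: t_def simp del: pi_gt_zero)
  have "48 * pi * (1 / 4) < t * norm (deriv G \<zeta>)" using t less pi_gt_zero by (intro mult_le_less_imp_less) auto
  then have r: "pi < r" by (simp add: r_def)
  have "t \<le> dist \<zeta> z" if "z \<in> frontier H" for z
  proof -
    have "z \<notin> H" using that open_H by (simp add: frontier_def interior_open)
    then have "t \<le> Re (\<zeta> - z)" by (simp add: H_def t_def)
    also have "\<dots> \<le> dist \<zeta> z" unfolding dist_norm by (rule complex_Re_le_cmod)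
    finally show ?thesis .
  qed
  moreover have "\<zeta> \<in> H" using t by (simp add: H_def t_def)
  ultimately obtain b where b: "ball b r \<subseteq> G ` H"
    using Bloch_general[of G H \<zeta> t r] G by (auto simp: r_def log_section_def)
  have "b + \<i> * pi \<in> ball b r" "b - \<i> * pi \<in> ball b r"
    using r by (simp_all add: dist_norm norm_mult)
  then have "b + \<i> * pi \<in> G ` H" "b - \<i> * pi \<in> G ` H" using b by blast+
  then obtain x y where x: "x \<in> H" "G x = b + \<i> * pi" and y: "y \<in> H" "G y = b - \<i> * pi"
    unfolding image_iff by metis
  have "b + \<i> * pi = (b - \<i> * pi) + of_int (2 * 1) * pi * \<i>" by (simp add: algebra_simps)
  then have "exp (b + \<i> * pi) = exp (b - \<i> * pi)" unfolding exp_eq by blast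
  then have "x = y" using G x y unfolding log_section_def by metis
  then show False using x y by (simp add: algebra_simps)
qed

lemma log_section_contracting:
  assumes G: "log_section \<phi> G" and \<zeta>: "ln R + 48 * pi \<le> Re \<zeta>" "ln R + 48 * pi \<le> Re \<zeta>'"
  shows "norm (G \<zeta> - G \<zeta>') \<le> norm (\<zeta> - \<zeta>') / 4"
proof -
  let ?S = "{\<zeta>. ln R + 48 * pi \<le> Re \<zeta>}"
  have "?S \<subseteq> H" using pi_gt_zero by (auto simp: H_def simp del: pi_gt_zero)
  then have "(G has_field_derivative deriv G z) (at z within ?S)" if "z \<in> ?S" for z
    using G that holomorphic_derivI[of G H z] open_H
    by (auto simp: log_section_def intro: has_field_derivative_at_within)
  then have "norm (G \<zeta> - G \<zeta>') \<le> 1 / 4 * norm (\<zeta> - \<zeta>')"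
    by (rule field_differentiable_bound[OF convex_halfspace_Re_ge])
      (use log_section_deriv[OF G] \<zeta> in auto)
  then show ?thesis by simp
qed

subsection \<open>Orbits in an invariant closed connected set\<close>

lemma log_branch_norm_ge: "\<phi> z \<in> H \<and> exp (\<phi> z) = f z \<Longrightarrow> exp M \<le> norm (f z) \<Longrightarrow> M \<le> norm (\<phi> z)"
  by (metis complex_Re_le_cmod exp_le_cancel_iff norm_exp_eq_Re order_trans)

text \<open>The points \<open>x\<close> of \<open>A\<close> whose image under the branch lies in the same component as \<open>\<phi> z\<close>
  form a clopen set unless some of them satisfy \<open>norm (f x) = \<rho>\<close>.\<close>

lemma log_section_meets_level:
  assumes A: "connected A" "a \<in> A" "norm (f a) \<le> \<rho>"
    and \<rho>: "R < \<rho>" and \<phi>: "continuous_on {z. R < norm (f z)} \<phi>"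
    and sec: "\<And>x. x \<in> A \<Longrightarrow> \<rho> \<le> norm (f x) \<Longrightarrow> \<exists>G. log_section \<phi> G \<and> \<phi> x \<in> G ` H"
    and G: "log_section \<phi> G" and z: "z \<in> A" "\<rho> \<le> norm (f z)" "\<phi> z \<in> G ` H"
  obtains x where "x \<in> A" "norm (f x) = \<rho>" "\<phi> x \<in> G ` H"
proof (rule ccontr)
  assume "\<not> thesis"
  then have no: "\<And>x. x \<in> A \<Longrightarrow> norm (f x) = \<rho> \<Longrightarrow> \<phi> x \<notin> G ` H" using that by blast
  have cn: "continuous_on UNIV (\<lambda>z. norm (f z))" by (intro continuous_intros cont)
  have opn: "open {z. c < norm (f z)}" for c
    by (rule open_Collect_less[OF continuous_on_const cn])
  have pre: "open ({z. R < norm (f z)} \<inter> \<phi> -` U)" if "open U" for U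
    using continuous_open_preimage[OF \<phi> opn that] .
  define \<U> where "\<U> = {G' ` H | G'. log_section \<phi> G' \<and> G' ` H \<inter> G ` H = {}}"
  define P where "P = {z. \<rho> < norm (f z)} \<inter> ({z. R < norm (f z)} \<inter> \<phi> -` (G ` H))"
  define Q where "Q = {z. norm (f z) < \<rho>} \<union> ({z. R < norm (f z)} \<inter> \<phi> -` \<Union> \<U>)"
  have "open P" unfolding P_def by (intro open_Int opn pre log_section_open[OF G])
  have "open {z. norm (f z) < \<rho>}" by (rule open_Collect_less[OF cn continuous_on_const])
  moreover have "open (\<Union> \<U>)" unfolding \<U>_def using log_section_open by auto
  ultimately have "open Q" unfolding Q_def by (intro open_Un pre)
  have "A \<subseteq> P \<union> Q"
  proof
    fix x assume x: "x \<in> A"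
    show "x \<in> P \<union> Q"
    proof (cases "norm (f x) < \<rho>")
      case False
      then obtain G' where G': "log_section \<phi> G'" "\<phi> x \<in> G' ` H" using sec x by force
      show ?thesis
      proof (cases "G' ` H \<inter> G ` H = {}")
        case True
        then show ?thesis using G' False \<rho> unfolding Q_def \<U>_def by auto
      next
        case False
        then have "G' ` H = G ` H" using log_section_unique[OF G'(1) G] by (intro image_cong) auto
        then have \<phi>x: "\<phi> x \<in> G ` H" using G'(2) by simp
        then have "\<rho> < norm (f x)" using no[OF x] \<open>\<not> norm (f x) < \<rho>\<close> by linarith
        then show ?thesis using \<phi>x \<rho> unfolding P_def by simp
      qed
    qed (simp add: Q_def)
  qed
  moreover have "P \<inter> Q \<inter> A = {}" unfolding P_def Q_def \<U>_def by auto
  moreover have "z \<in> P \<inter> A" using z no[OF z(1)] \<rho> unfolding P_def by force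
  moreover have "a \<in> Q \<inter> A"
  proof (cases "a \<in> P")
    case True then show ?thesis using A by (simp add: P_def)
  qed (use \<open>A \<subseteq> P \<union> Q\<close> A in auto)
  ultimately show False
    using connectedD[OF A(1) \<open>open P\<close> \<open>open Q\<close>] by blast
qed

text \<open>The set \<open>S\<close> below is forward invariant, \<open>norm (\<phi> z)\<close> at
  least doubles along its orbits, and it contains all points of \<open>A\<close> of large modulus.
  Bounds for \<open>\<phi>\<close> on bounded parts of \<open>A\<close> turn this growth into
  statements about the orbit itself.\<close>

lemma eventually_large:
  assumes A: "closed A" "connected A" "f ` A \<subseteq> A"
    and proper: "\<And>K. bounded {z \<in> A. norm (f z) \<le> K}" and "0 < (r::real)"
  shows "\<exists>r'>0. \<forall>z\<in>A. r' \<le> norm z \<longrightarrow>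
    (\<forall>n. r \<le> norm ((f ^^ n) z)) \<and> filterlim (\<lambda>n. norm ((f ^^ n) z)) at_top sequentially"
proof (cases "A = {}")
  case True
  then show ?thesis by (auto intro: exI[of _ 1])
next
  case False
  then obtain a where a: "a \<in> A" by blast
  obtain \<phi> where \<phi>: "continuous_on {z. R < norm (f z)} \<phi>"
    "\<And>z. R < norm (f z) \<Longrightarrow> \<phi> z \<in> H \<and> exp (\<phi> z) = f z"
    "\<And>z. R < norm (f z) \<Longrightarrow> \<exists>g. exp_lift g \<and> g (\<phi> z) = z \<and> (\<forall>\<zeta>\<in>H. \<phi> (g \<zeta>) = \<zeta>)"
    using log_branch_exists by metis
  \<comment> \<open>From this level on, \<open>\<phi>\<close> takes values in the half-plane where
    sections contract by the factor \<open>1 / 4\<close>.\<close>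
  define \<rho>\<^sub>1 where "\<rho>\<^sub>1 = R * exp (48 * pi)"
  have "R * 1 < \<rho>\<^sub>1" unfolding \<rho>\<^sub>1_def using R_pos pi_gt_zero by (intro mult_strict_left_mono) auto
  then have \<rho>1: "R < \<rho>\<^sub>1" by simp
  have Re\<phi>: "ln R + 48 * pi \<le> Re (\<phi> z)" if "\<rho>\<^sub>1 \<le> norm (f z)" for z
  proof -
    have "\<rho>\<^sub>1 \<le> exp (Re (\<phi> z))" using \<phi>(2)[of z] that \<rho>1 norm_exp_eq_Re by (metis order_less_le_trans)
    moreover have "\<rho>\<^sub>1 = exp (ln R + 48 * pi)" using R_pos by (simp add: \<rho>\<^sub>1_def exp_add)
    ultimately show ?thesis by simp
  qed
  obtain B where B: "\<And>z. z \<in> A \<Longrightarrow> norm (f z) \<le> \<rho>\<^sub>1 \<Longrightarrow> norm z \<le> B"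
    using proper[of \<rho>\<^sub>1] unfolding bounded_iff by blast
  \<comment> \<open>Exceeding \<open>B\<close> ensures that \<open>\<rho> \<le> norm (f x)\<close>
    implies \<open>\<rho>\<^sub>1 \<le> norm (f (f x))\<close>; dominating \<open>norm (f a)\<close>
    provides the base point for \<open>log_section_meets_level\<close>.\<close>
  define \<rho> where "\<rho> = max (B + 1) (max \<rho>\<^sub>1 (norm (f a)))"
  have \<rho>: "\<rho>\<^sub>1 \<le> \<rho>" "norm (f a) \<le> \<rho>" "B < \<rho>" by (auto simp: \<rho>_def)
  have ff: "f x \<in> A \<and> \<rho>\<^sub>1 \<le> norm (f (f x))" if "x \<in> A" "\<rho> \<le> norm (f x)" for x
  proof -
    have "f x \<in> A" using that A(3) by blast
    then show ?thesis using B[of "f x"] that \<rho> by linarith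
  qed
  have bounded_\<phi>: "bounded (\<phi> ` S)" if S: "bounded S" "S \<subseteq> {x \<in> A. \<rho>\<^sub>1 \<le> norm (f x)}" for S
  proof -
    obtain K where "\<And>x. x \<in> S \<Longrightarrow> norm x \<le> K" using S(1) unfolding bounded_iff by blast
    then have K: "S \<subseteq> cball 0 K" by auto
    let ?C = "(A \<inter> {x. \<rho>\<^sub>1 \<le> norm (f x)}) \<inter> cball 0 K"
    have "closed {x. \<rho>\<^sub>1 \<le> norm (f x)}"
      by (intro closed_Collect_le continuous_intros cont)
    then have "compact ?C" by (intro closed_Int_compact closed_Int A(1) compact_cball)
    then have "compact (\<phi> ` ?C)"
      by (intro compact_continuous_image continuous_on_subset[OF \<phi>(1)]) (use \<rho>1 in auto)
    then show ?thesis
      by (rule bounded_subset[OF compact_imp_bounded]) (use K S(2) in auto)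
  qed
  define Y where "Y = {x \<in> A. norm (f x) = \<rho>}"
  have "bounded Y" by (rule bounded_subset[OF proper[of \<rho>]]) (auto simp: Y_def)
  then have "bounded (\<phi> ` Y)" by (rule bounded_\<phi>) (use \<rho> in \<open>auto simp: Y_def\<close>)
  moreover have "bounded (f ` Y)" by (rule bounded_subset[OF bounded_cball[of 0 \<rho>]]) (auto simp: Y_def)
  then have "bounded (\<phi> ` f ` Y)" by (rule bounded_\<phi>) (use ff in \<open>auto simp: Y_def\<close>)
  ultimately have "bounded (\<phi> ` Y \<union> \<phi> ` f ` Y)" by simp
  then obtain C where C: "0 < C" "\<And>x. x \<in> Y \<Longrightarrow> norm (\<phi> x) \<le> C" "\<And>x. x \<in> Y \<Longrightarrow> norm (\<phi> (f x)) \<le> C"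
    unfolding bounded_pos by auto
  have sec: "\<exists>G. log_section \<phi> G \<and> G (\<phi> (f x)) = \<phi> x \<and> \<phi> x \<in> G ` H" if x: "x \<in> A" "\<rho> \<le> norm (f x)" for x
  proof -
    have fx: "R < norm (f x)" and ffx: "R < norm (f (f x))" using x ff[OF x] \<rho> \<rho>1 by linarith+
    have e: "exp (\<phi> x) = f x" using \<phi>(2)[OF fx] by simp
    obtain g where "exp_lift g" "g (\<phi> (f x)) = f x" "\<And>\<zeta>. \<zeta> \<in> H \<Longrightarrow> \<phi> (g \<zeta>) = \<zeta>"
      using \<phi>(3)[OF ffx] by blast
    then obtain G where "log_section \<phi> G" "G (\<phi> (exp (\<phi> x))) = \<phi> x"
      using log_section_exists[of g \<phi> "\<phi> x"] \<phi>(2)[OF ffx] e by metis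
    then show ?thesis using \<phi>(2)[OF ffx] e by (metis image_eqI)
  qed
  \<comment> \<open>With \<open>x\<close> on the level \<open>\<rho>\<close>, contraction gives
    \<open>norm (\<phi> z) - C \<le> (norm (\<phi> (f z)) + C) / 4\<close>, whence the term
    \<open>5 * C\<close>.\<close>
  have growth: "4 * norm (\<phi> z) - 5 * C \<le> norm (\<phi> (f z))" if z: "z \<in> A" "\<rho> \<le> norm (f z)" for z
  proof -
    obtain G where G: "log_section \<phi> G" "G (\<phi> (f z)) = \<phi> z" "\<phi> z \<in> G ` H" using sec[OF z] by blast
    obtain x where x: "x \<in> A" "norm (f x) = \<rho>" "\<phi> x \<in> G ` H"
    proof (rule log_section_meets_level[OF A(2) a \<rho>(2) _ \<phi>(1) _ G(1) z G(3)])
      show "\<exists>G. log_section \<phi> G \<and> \<phi> x \<in> G ` H" if "x \<in> A" "\<rho> \<le> norm (f x)" for x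
        using sec[OF that] by blast
    qed (use \<rho> \<rho>1 in auto)
    have "exp (\<phi> x) = f x" using \<phi>(2)[of x] x(2) \<rho> \<rho>1 by auto
    moreover obtain \<zeta> where \<zeta>: "\<zeta> \<in> H" "\<phi> x = G \<zeta>" using x(3) by blast
    \<comment> \<open>Since \<open>exp (G \<zeta>) = f x\<close>, the section property gives
      \<open>\<phi> (f x) = \<zeta>\<close>: the same \<open>G\<close> serves both \<open>z\<close>
      and \<open>x\<close>.\<close>
    ultimately have Gx: "G (\<phi> (f x)) = \<phi> x" using G(1) unfolding log_section_def by metis
    have "norm (\<phi> z - \<phi> x) \<le> norm (\<phi> (f z) - \<phi> (f x)) / 4"
      using log_section_contracting[OF G(1) Re\<phi> Re\<phi>, of "f z" "f x"] ff z x G(2) Gx by simp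
    moreover have "norm (\<phi> x) \<le> C" "norm (\<phi> (f x)) \<le> C" using C x by (auto simp: Y_def)
    moreover have "norm (\<phi> z) - norm (\<phi> x) \<le> norm (\<phi> z - \<phi> x)" by (rule norm_triangle_ineq2)
    moreover have "norm (\<phi> (f z) - \<phi> (f x)) \<le> norm (\<phi> (f z)) + norm (\<phi> (f x))"
      by (rule norm_triangle_ineq4)
    ultimately show ?thesis by simp
  qed
  define S\<^sub>1 where "S\<^sub>1 = {x \<in> A. \<rho>\<^sub>1 \<le> norm (f x) \<and> norm (f x) \<le> \<rho>}"
  define S\<^sub>2 where "S\<^sub>2 K = {x \<in> A. \<rho>\<^sub>1 \<le> norm (f x) \<and> norm x \<le> K}" for K
  have "bounded S\<^sub>1" by (rule bounded_subset[OF proper[of \<rho>]]) (auto simp: S\<^sub>1_def)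
  then have bS1: "bounded (\<phi> ` S\<^sub>1)" by (rule bounded_\<phi>) (auto simp: S\<^sub>1_def)
  have bS2: "bounded (\<phi> ` S\<^sub>2 K)" for K
    by (rule bounded_\<phi>[OF bounded_subset[OF bounded_cball[of 0 K]]]) (auto simp: S\<^sub>2_def)
  have "bounded (\<phi> ` S\<^sub>1 \<union> \<phi> ` S\<^sub>2 r)" using bS1 bS2 by simp
  then obtain D where D: "\<And>x. x \<in> S\<^sub>1 \<Longrightarrow> norm (\<phi> x) \<le> D" "\<And>x. x \<in> S\<^sub>2 r \<Longrightarrow> norm (\<phi> x) \<le> D"
    unfolding bounded_iff by auto
  \<comment> \<open>The part \<open>5 * C\<close> turns \<open>growth\<close> into doubling. The
    part \<open>D + 1\<close> keeps points with \<open>M \<le> norm (\<phi> x)\<close> out of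
    \<open>S\<^sub>1\<close>, so that \<open>S\<close> is invariant, and out of
    \<open>S\<^sub>2 r\<close>, so that points of \<open>S\<close> have modulus at least
    \<open>r\<close>.\<close>
  define M where "M = max (5 * C) (D + 1)"
  have M: "0 < M" "5 * C \<le> M" "D < M" using C by (auto simp: M_def)
  define S where "S = {z \<in> A. \<rho> \<le> norm (f z) \<and> M \<le> norm (\<phi> z)}"
  have step: "f z \<in> S \<and> 2 * norm (\<phi> z) \<le> norm (\<phi> (f z))" if z: "z \<in> S" for z
  proof -
    have z': "z \<in> A" "\<rho> \<le> norm (f z)" "M \<le> norm (\<phi> z)" using z by (auto simp: S_def)
    have g: "2 * norm (\<phi> z) \<le> norm (\<phi> (f z))" using growth[OF z'(1,2)] z'(3) M by linarith
    then have "M \<le> norm (\<phi> (f z))" using z'(3) M by linarith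
    moreover from this have "f z \<notin> S\<^sub>1" using D(1)[of "f z"] M by linarith
    ultimately show ?thesis using ff[OF z'(1,2)] g by (auto simp: S_def S\<^sub>1_def)
  qed
  have iter: "(f ^^ n) z \<in> S \<and> 2 ^ n * M \<le> norm (\<phi> ((f ^^ n) z))" if z: "z \<in> S" for n z
  proof (induction n)
    case 0 then show ?case using z by (simp add: S_def)
  next
    case (Suc n) then show ?case using step[of "(f ^^ n) z"] by auto
  qed
  have S_r: "r \<le> norm z" if "z \<in> S" for z
    using D(2)[of z] that M \<rho> by (force simp: S_def S\<^sub>2_def)
  have S_lim: "filterlim (\<lambda>n. norm ((f ^^ n) z)) at_top sequentially" if z: "z \<in> S" for z
    unfolding filterlim_at_top
  proof
    fix K
    obtain E where E: "\<And>x. x \<in> S\<^sub>2 K \<Longrightarrow> norm (\<phi> x) \<le> E" using bS2[of K] unfolding bounded_iff by auto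
    have "filterlim (\<lambda>n. 2 ^ n * M) at_top sequentially" using M(1) by real_asymp
    then have "eventually (\<lambda>n. E < 2 ^ n * M) sequentially" unfolding filterlim_at_top_dense by blast
    then show "eventually (\<lambda>n. K \<le> norm ((f ^^ n) z)) sequentially"
    proof eventually_elim
      case (elim n)
      then have "(f ^^ n) z \<notin> S\<^sub>2 K" using E[of "(f ^^ n) z"] iter[OF z, of n] by linarith
      then show ?case using iter[OF z, of n] \<rho> by (auto simp: S_def S\<^sub>2_def)
    qed
  qed
  obtain B' where B': "\<And>z. z \<in> A \<Longrightarrow> norm (f z) \<le> max \<rho> (exp M) \<Longrightarrow> norm z \<le> B'"
    using proper[of "max \<rho> (exp M)"] unfolding bounded_iff by blast
  define r' where "r' = max B' 0 + 1"
  have "z \<in> S" if "z \<in> A" "r' \<le> norm z" for z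
  proof -
    \<comment> \<open>The bound by \<open>exp M\<close> yields
      \<open>M \<le> norm (\<phi> z)\<close>, because the real part of \<open>\<phi> z\<close> is
      \<open>ln (norm (f z))\<close>.\<close>
    have "max \<rho> (exp M) < norm (f z)" using B'[OF that(1)] that(2) by (force simp: r'_def)
    then show ?thesis using that(1) log_branch_norm_ge[of \<phi> z M] \<phi>(2)[of z] \<rho> \<rho>1 by (auto simp: S_def)
  qed
  moreover have "0 < r'" by (simp add: r'_def)
  ultimately show ?thesis using S_lim S_r iter by (intro exI[of _ r']) blast
qed

end

section \<open>Properness on \<open>A\<close> and the final deduction\<close>

text \<open>The set is contained in the image under the continuous inverse \<open>g\<close> of the
  compact set \<open>B \<inter> cball w K\<close>.\<close>

lemma homeomorphism_onto_closed_proper: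
  fixes f :: "'a::metric_space \<Rightarrow> 'b::heine_borel"
  assumes "homeomorphism A B f g" "closed B"
  shows "bounded {z \<in> A. f z \<in> cball w K}"
proof -
  have "compact (B \<inter> cball w K)" using assms(2) by (intro closed_Int_compact compact_cball)
  then have "compact (g ` (B \<inter> cball w K))"
    using assms(1) by (intro compact_continuous_image) (auto simp: homeomorphism_def intro: continuous_on_subset)
  moreover have "{z \<in> A. f z \<in> cball w K} \<subseteq> g ` (B \<inter> cball w K)"
    using assms(1) by (force simp: homeomorphism_def intro!: image_eqI)
  ultimately show ?thesis using bounded_subset compact_imp_bounded by blast
qed

theorem theorem5:
  fixes f :: "complex \<Rightarrow> complex" and A :: "complex set"
  assumes "f \<in> eremenko_lyubich"
    and "closed A" and "connected A"
    and "f ` A \<subseteq> A"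
    and "\<exists>g. homeomorphism A (closure (f ` A)) f g"
  shows "\<forall>R>0. \<exists>R'>0.
    {z \<in> A. norm z \<ge> R'} \<subseteq>
    {z. (\<forall>n. norm ((f ^^ n) z) \<ge> R) \<and>
        filterlim (\<lambda>n. norm ((f ^^ n) z)) at_top sequentially}"
proof (intro allI impI)
  fix R :: real assume "0 < R"
  obtain B where B: "\<And>a. a \<in> sing_inv f \<Longrightarrow> norm a \<le> B"
    using assms(1) closure_subset unfolding eremenko_lyubich_def singular_set_def bounded_iff by blast
  \<comment> \<open>The three terms bound the singular values, bound \<open>f 0\<close> and ensure
    positivity.\<close>
  define R\<^sub>0 where "R\<^sub>0 = max (max B (norm (f 0))) 1"
  interpret class_B_covering f R\<^sub>0
  proof
    show "f holomorphic_on UNIV" "\<not> (\<exists>p. \<forall>z. f z = poly p z)"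
      using assms(1) by (auto simp: eremenko_lyubich_def transcendental_entire_def)
    show "deriv f z \<noteq> 0" if "R\<^sub>0 < norm (f z)" for z
      using that B[of "f z"] by (auto simp: R\<^sub>0_def sing_inv_def critical_values_def)
    show "a \<notin> asymptotic_values f" if "R\<^sub>0 < norm a" for a
      using that B[of a] by (auto simp: R\<^sub>0_def sing_inv_def)
  qed (auto simp: R\<^sub>0_def)
  have "bounded {z \<in> A. norm (f z) \<le> K}" for K
    using assms(5) homeomorphism_onto_closed_proper[of A "closure (f ` A)" f _ 0 K] by auto
  then obtain r' where "r' > 0" "\<forall>z\<in>A. r' \<le> norm z \<longrightarrow>
    (\<forall>n. R \<le> norm ((f ^^ n) z)) \<and> filterlim (\<lambda>n. norm ((f ^^ n) z)) at_top sequentially"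
    using eventually_large[OF assms(2-4) _ \<open>0 < R\<close>] by blast
  then show "\<exists>R'>0. {z \<in> A. norm z \<ge> R'} \<subseteq>
    {z. (\<forall>n. norm ((f ^^ n) z) \<ge> R) \<and> filterlim (\<lambda>n. norm ((f ^^ n) z)) at_top sequentially}"
    by (intro exI[of _ r']) auto
qed

end
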